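(* Let $r=r(n)$ be positive integers with $r<n/2$, and write $r=c_n n^{1/3}$. Run the random process described in the context, producing the final intersecting family $\mathcal F$, and let $\mathcal E_{n,r}$ be the event that $|\mathcal F|=\binom{n-1}{r-1}$ (for $r<n/2$ this is equivalent to the existence of some $x\in[n]$ contained in every member of $\mathcal F$). Then $$\lim_{n\to\infty}\Pr(\mathcal E_{n,r})=\begin{cases}1 & \text{if } c_n\to 0,\\ \dfrac{1}{1+c^3} & \text{if } c_n\to c\in(0,\infty),\\ 0 & \text{if } c_n\to\infty.\end{cases}$$
   Context: Random intersecting process: Let $[n]=\{1,\dots,n\}$ and $\binom{[n]}{r}$ the family of $r$-subsets of $[n]$. Choose $e_1$ uniformly at random from $\binom{[n]}{r}$. Given $\mathcal F_i=\{e_1,\dots,e_i\}$, let $\mathcal A(\mathcal F_i)=\{e\in\binom{[n]}{r}: e\notin\mathcal F_i,\ e\cap e_j\neq\emptyset \text{ for all } 1\le j\le i\}$, and choose $e_{i+1}$ uniformly at random from $\mathcal A(\mathcal F_i)$. The process halts when $\mathcal A(\mathcal F_i)=\emptyset$ and outputs $\mathcal F=\mathcal F_i$. All limits are as $n\to\infty$. *)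

theory Defs
  imports "HOL-Probability.Probability"
begin

definition rsets :: "nat \<Rightarrow> nat \<Rightarrow> nat set set" where
  "rsets n r = {e. e \<subseteq> {1..n} \<and> card e = r}"

definition avail :: "nat \<Rightarrow> nat \<Rightarrow> nat set set \<Rightarrow> nat set set" where
  "avail n r F = {e \<in> rsets n r. e \<notin> F \<and> (\<forall>f\<in>F. e \<inter> f \<noteq> {})}"

definition step :: "nat \<Rightarrow> nat \<Rightarrow> nat set set \<Rightarrow> nat set set pmf" where
  "step n r F = (if avail n r F = {} then return_pmf F
                 else map_pmf (\<lambda>e. insert e F) (pmf_of_set (avail n r F)))"

text \<open>Distribution of the output family: starting from the empty family
  (so e_1 is uniform over all r-subsets), iterate the step as many times as there
  are r-subsets; each non-halting step adds a new r-subset, so the process has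
  halted by then.\<close>
definition process :: "nat \<Rightarrow> nat \<Rightarrow> nat set set pmf" where
  "process n r = ((\<lambda>p. bind_pmf p (step n r)) ^^ card (rsets n r)) (return_pmf {})"

definition probE :: "nat \<Rightarrow> nat \<Rightarrow> real" where
  "probE n r = measure_pmf.prob (process n r) {F. card F = (n - 1) choose (r - 1)}"

end

theory Submission
  imports Defs "HOL-Combinatorics.Multiset_Permutations" "HOL-Real_Asymp.Real_Asymp"
begin

text \<open>
  By the uniqueness part of the Erdos-Ko-Rado theorem the event is that the final family is a star.
  Being a star can only be lost along the process.

  If \<open>r = O(n\<^bsup>1/3\<^esup>)\<close>, then with high probability \<open>e\<^sub>1\<close> and \<open>e\<^sub>2\<close> meet in a single point \<open>x\<close>. About
  \<open>r\<^sup>2 (r/n) M = c\<^sup>3 M\<close> of the choices for \<open>e\<^sub>3\<close> avoid \<open>x\<close> and about \<open>M = C(n-1, r-1)\<close> contain it, so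
  \<open>e\<^sub>3\<close> contains \<open>x\<close> with probability close to \<open>1/(1 + c\<^sup>3)\<close>. From then on the star survives: the first
  \<open>k\<close> members, as long as they form a star at \<open>x\<close>, have probability at most a constant over \<open>n\<close> times that of
  a uniform \<open>k\<close>-subset of the full star, and for such a subset the expected number of \<open>r\<close>-sets avoiding \<open>x\<close>
  and meeting all members is at most \<open>C(n-1, r) \<rho>\<^bsup>k\<^esup>\<close> with \<open>\<rho> \<approx> r\<^sup>2/n\<close>; summed over \<open>k \<ge> 3\<close> this is
  negligible.

  If \<open>r\<close> is much larger than \<open>n\<^bsup>1/3\<^esup>\<close>, the expected number of common points of the first \<open>k\<close> members is
  at most \<open>n\<close> times the product of the ratios of \<open>M\<close> to the number of available sets. For \<open>r \<le> n\<^bsup>3/5\<^esup>\<close>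
  this tends to 0 with \<open>k = 3\<close>; for larger \<open>r\<close> almost all \<open>r\<close>-sets remain available and \<open>k = n - 1\<close> works.
\<close>

section \<open>Uniqueness in the Erdos-Ko-Rado theorem\<close>

text \<open>Katona's cycle method: \<open>xs\<close> is read as a cyclic order. Starting positions
  are not reduced, so \<open>arc r xs j\<close> is periodic in \<open>j\<close> with period
  \<open>length xs\<close>.\<close>

definition arc :: "nat \<Rightarrow> 'a list \<Rightarrow> nat \<Rightarrow> 'a set" where
  "arc r xs j = set (take r (rotate j xs))"

definition arc_count :: "nat \<Rightarrow> 'a set set \<Rightarrow> 'a list \<Rightarrow> nat" where
  "arc_count r F xs = (\<Sum>j<length xs. if arc r xs j \<in> F then 1 else 0)"

lemma arc_count_card: "arc_count r F xs = card {j. j < length xs \<and> arc r xs j \<in> F}"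
proof -
  have "arc_count r F xs = card ({..<length xs} \<inter> {j. arc r xs j \<in> F})"
    unfolding arc_count_def by (simp add: sum.If_cases)
  also have "{..<length xs} \<inter> {j. arc r xs j \<in> F} = {j. j < length xs \<and> arc r xs j \<in> F}" by auto
  finally show ?thesis .
qed

lemma arc_rotate: "arc r (rotate k xs) j = arc r xs (j + k)"
  by (simp add: arc_def rotate_rotate)

lemma arc_length: "arc r xs (length xs + j) = arc r xs j"
  unfolding arc_def by (metis mod_add_self1 rotate_conv_mod)

lemma arc_count_rotate: "arc_count r F (rotate k xs) = arc_count r F xs"
proof (induction k)
  case (Suc k)
  define h where "h j = (if arc r (rotate k xs) j \<in> F then 1 else (0::nat))" for j
  let ?n = "length xs"
  have "arc_count r F (rotate (Suc k) xs) = (\<Sum>j<?n. h (Suc j))"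
    unfolding arc_count_def h_def by (simp add: arc_rotate del: rotate_Suc)
  moreover have "h 0 + (\<Sum>j<?n. h (Suc j)) = (\<Sum>j<?n. h j) + h ?n"
    using sum.lessThan_Suc_shift[of h ?n] by simp
  moreover have "h ?n = h 0"
    using arc_length[of r "rotate k xs" 0] by (simp add: h_def)
  ultimately show ?case using Suc by (simp add: arc_count_def h_def)
qed simp

lemma arc_disjoint_zero:
  assumes "distinct xs" "r \<le> j" "j + r \<le> length xs"
  shows "arc r xs 0 \<inter> arc r xs j = {}"
proof -
  have "rotate j xs = drop j xs @ take j xs"
    using assms by (cases "j = length xs") (auto simp: rotate_drop_take)
  then have "arc r xs j \<subseteq> set (drop j xs)"
    using assms by (auto simp: arc_def dest: in_set_takeD)
  moreover have "set (drop j xs) \<inter> set (take r xs) = {}"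
    using assms set_take_disj_set_drop_if_distinct[of xs r j] by auto
  ultimately show ?thesis by (auto simp: arc_def)
qed

locale intersecting_family =
  fixes F :: "'a set set" and r :: nat
  assumes meet: "\<And>e f. e \<in> F \<Longrightarrow> f \<in> F \<Longrightarrow> e \<inter> f \<noteq> {}"
begin

text \<open>The arc starting \<open>r\<close> positions before \<open>i\<close> ends just before
  \<open>i\<close>, so the two arcs are consecutive blocks of a cycle with more than
  \<open>2 * r\<close> positions.\<close>

lemma opposite_arcs:
  assumes "distinct xs" "2 * r < length xs" "0 < i" "i < r"
  shows "\<not> (arc r xs i \<in> F \<and> arc r xs (length xs + i - r) \<in> F)"
proof
  assume *: "arc r xs i \<in> F \<and> arc r xs (length xs + i - r) \<in> F"
  let ?k = "length xs + i - r"
  have "arc r (rotate ?k xs) 0 \<inter> arc r (rotate ?k xs) r = {}"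
    using assms by (intro arc_disjoint_zero) auto
  moreover have "arc r (rotate ?k xs) r = arc r xs i"
    using arc_length[of r xs i] assms by (simp add: arc_rotate)
  ultimately show False using * meet by (auto simp: arc_rotate)
qed

text \<open>Among the arcs meeting the arc at 0, those starting at \<open>i\<close> and at \<open>i - r\<close> (mod the length)
  are disjoint, so each of these \<open>r - 1\<close> pairs contributes at most one member of \<open>F\<close>.\<close>
lemma arcs_through_zero:
  assumes "distinct xs" "2 * r < length xs" "0 < r" "arc r xs 0 \<in> F"
  shows "arc_count r F xs \<le> r"
    and "arc_count r F xs = r \<Longrightarrow> 0 < i \<Longrightarrow> i < r \<Longrightarrow>
          arc r xs i \<in> F \<or> arc r xs (length xs + i - r) \<in> F"
proof -
  let ?n = "length xs"
  define J where "J = {j. j < ?n \<and> arc r xs j \<in> F}"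
  \<comment> \<open>\<open>g\<close> gives both members of a disjoint pair the same label: the arcs
    at \<open>i\<close> and at \<open>?n + i - r\<close> go to \<open>i\<close>. Injectivity of
    \<open>g\<close> on \<open>J - {0}\<close> then says that no pair is used twice.\<close>
  define g where "g j = (if j < r then j else j + r - ?n)" for j
  have fin: "finite J" by (simp add: J_def)
  have J0: "0 \<in> J" using assms by (auto simp: J_def)
  have rng: "j < r \<or> ?n < j + r" if "j \<in> J" for j
    using arc_disjoint_zero[of xs r j] assms that meet[of "arc r xs 0" "arc r xs j"]
    by (force simp: J_def)
  have sub: "g ` (J - {0}) \<subseteq> {0<..<r}"
  proof
    fix y assume "y \<in> g ` (J - {0})"
    then obtain j where j: "j \<in> J" "j \<noteq> 0" "y = g j" by auto
    then show "y \<in> {0<..<r}" using rng[OF j(1)] by (auto simp: g_def J_def)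
  qed
  have opp: "\<not> (i \<in> J \<and> ?n + i - r \<in> J)" if "0 < i" "i < r" for i
    using opposite_arcs[OF assms(1,2) that] by (auto simp: J_def)
  have inj: "inj_on g (J - {0})"
  proof (rule inj_onI)
    fix j k assume *: "j \<in> J - {0}" "k \<in> J - {0}" "g j = g k"
    have jn: "j < ?n" "k < ?n" using * by (auto simp: J_def)
    have "?n + j - r = k" if "j < r" "\<not> k < r"
      using that * rng[of k] jn by (auto simp: g_def)
    moreover have "?n + k - r = j" if "k < r" "\<not> j < r"
      using that * rng[of j] jn by (auto simp: g_def)
    ultimately show "j = k"
      using * opp[of j] opp[of k] rng[of j] rng[of k] by (auto simp: g_def split: if_splits)
  qed
  have cJ: "card J = Suc (card (g ` (J - {0})))"
    using card_image[OF inj] J0 fin by (metis card_Suc_Diff1)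
  have "card (g ` (J - {0})) \<le> r - 1"
    using card_mono[OF _ sub] by simp
  with cJ show "arc_count r F xs \<le> r" using assms by (simp add: arc_count_card J_def)
  assume eq: "arc_count r F xs = r" and i: "0 < i" "i < r"
  have "card (g ` (J - {0})) = card {0<..<r}"
    using eq cJ by (simp add: arc_count_card J_def)
  then have "g ` (J - {0}) = {0<..<r}"
    using sub by (intro card_subset_eq) auto
  then have "i \<in> g ` (J - {0})" using i by simp
  then obtain j where j: "j \<in> J" "j \<noteq> 0" "g j = i" by blast
  then have "j = i \<or> j = ?n + i - r"
    using rng[of j] by (auto simp: g_def split: if_splits)
  then show "arc r xs i \<in> F \<or> arc r xs (?n + i - r) \<in> F" using j by (auto simp: J_def)
qed

lemma arc_count_le:
  assumes "distinct xs" "2 * r < length xs" "0 < r"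
  shows "arc_count r F xs \<le> r"
proof (cases "\<exists>j. arc r xs j \<in> F")
  case True
  then obtain j where "arc r (rotate j xs) 0 \<in> F" by (auto simp: arc_rotate)
  then have "arc_count r F (rotate j xs) \<le> r"
    using assms by (intro arcs_through_zero(1)) auto
  then show ?thesis by (simp add: arc_count_rotate)
next
  case False
  then show ?thesis by (simp add: arc_count_def)
qed

end

section \<open>Double counting of arcs over all cyclic orders\<close>

lemma card_permutations_prefix:
  assumes "finite V" "e \<subseteq> V" "card e = r"
  shows "card {xs \<in> permutations_of_set V. set (take r xs) = e} = fact r * fact (card V - r)"
proof -
  have fe: "finite e" using assms finite_subset by auto
  have rV: "r \<le> card V" using assms card_mono by auto
  let ?h = "\<lambda>(ys, zs). ys @ zs"
  have "bij_betw ?h (permutations_of_set e \<times> permutations_of_set (V - e))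
         {xs \<in> permutations_of_set V. set (take r xs) = e}"
  proof (rule bij_betwI[where g = "\<lambda>xs. (take r xs, drop r xs)"], goal_cases)
    case 1
    have "length ys = r" if "set ys = e" "distinct ys" for ys
      using that assms distinct_card by force
    then show ?case using assms by (auto simp: permutations_of_set_def)
  next
    case 2
    have "set (drop r xs) = V - e" if "set xs = V" "distinct xs" "set (take r xs) = e" for xs
      using that set_take_disj_set_drop_if_distinct[of xs r r] set_append[of "take r xs" "drop r xs"]
      by auto
    then show ?case by (auto simp: permutations_of_set_def)
  next
    case (3 p)
    have "length ys = r" if "set ys = e" "distinct ys" for ys
      using that assms distinct_card by force
    with 3 show ?case by (auto simp: permutations_of_set_def)
  qed auto
  from bij_betw_same_card[OF this]
  have "card {xs \<in> permutations_of_set V. set (take r xs) = e} =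
      card (permutations_of_set e) * card (permutations_of_set (V - e))"
    by (simp add: card_cartesian_product)
  then show ?thesis using assms fe by (simp add: card_Diff_subset)
qed

text \<open>Rotation by \<open>j\<close> permutes the permutations of \<open>V\<close>, so each of
  the \<open>card V\<close> starting positions contributes as much as position 0, where the arc is
  the prefix of length \<open>r\<close>.\<close>

lemma sum_arc_count:
  assumes "finite V" "F \<subseteq> {e. e \<subseteq> V \<and> card e = r}"
  shows "(\<Sum>xs\<in>permutations_of_set V. arc_count r F xs) =
           card V * (card F * (fact r * fact (card V - r)))"
proof -
  let ?P = "permutations_of_set V"
  have finF: "finite F"
    by (rule finite_subset[of _ "Pow V"]) (use assms in auto)
  have pref: "card {xs\<in>?P. set (take r xs) \<in> F} = card F * (fact r * fact (card V - r))"
  proof -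
    have "{xs\<in>?P. set (take r xs) \<in> F} = (\<Union>e\<in>F. {xs\<in>?P. set (take r xs) = e})" by auto
    also have "card \<dots> = (\<Sum>e\<in>F. card {xs\<in>?P. set (take r xs) = e})"
      using finF by (intro card_UN_disjoint) auto
    also have "\<dots> = (\<Sum>e\<in>F. fact r * fact (card V - r))"
      using assms by (intro sum.cong card_permutations_prefix) auto
    finally show ?thesis by simp
  qed
  have rot: "(\<Sum>xs\<in>?P. if arc r xs j \<in> F then 1 else 0) = card {xs\<in>?P. set (take r xs) \<in> F}" for j
  proof -
    have inj: "inj_on (rotate j) ?P"
      unfolding rotate_def by (rule inj_on_subset[OF inj_fn[OF inj_rotate1]]) simp
    have "rotate j ` ?P \<subseteq> ?P" by (auto simp: permutations_of_set_def)
    then have im: "rotate j ` ?P = ?P" using inj by (simp add: endo_inj_surj)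
    have "(\<Sum>xs\<in>?P. if arc r xs j \<in> F then 1 else (0::nat)) =
          (\<Sum>xs\<in>rotate j ` ?P. if set (take r xs) \<in> F then 1 else 0)"
      using inj by (subst sum.reindex) (auto simp: arc_def)
    also have "\<dots> = card (?P \<inter> {xs. set (take r xs) \<in> F})"
      unfolding im by (simp add: sum.If_cases)
    finally show ?thesis by (simp add: Int_def)
  qed
  have "(\<Sum>xs\<in>?P. arc_count r F xs) = (\<Sum>xs\<in>?P. \<Sum>j<card V. if arc r xs j \<in> F then 1 else 0)"
    by (intro sum.cong) (auto simp: arc_count_def permutations_of_set_def distinct_card)
  also have "\<dots> = (\<Sum>j<card V. \<Sum>xs\<in>?P. if arc r xs j \<in> F then 1 else 0)"
    by (rule sum.swap)
  finally show ?thesis by (simp add: rot pref)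
qed

section \<open>The equality case: families of extremal size and exchange of points\<close>

locale extremal_family = intersecting_family F r for F :: "'a set set" and r +
  fixes V :: "'a set"
  assumes finV: "finite V" and two_r: "2 * r < card V" and r2: "2 \<le> r"
    and uniform: "F \<subseteq> {e. e \<subseteq> V \<and> card e = r}"
    and size: "card F = (card V - 1) choose (r - 1)"
begin

lemma member: "A \<in> F \<Longrightarrow> A \<subseteq> V \<and> card A = r \<and> finite A"
  using uniform finV by (auto dest: finite_subset)

text \<open>Extremal size makes the average of \<open>arc_count\<close> over all permutations
  exactly \<open>r\<close>, while \<open>arc_count_le\<close> caps every single term at
  \<open>r\<close>.\<close>

lemma arc_count_eq:
  assumes "xs \<in> permutations_of_set V"
  shows "arc_count r F xs = r"
proof -
  let ?P = "permutations_of_set V"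
  have le: "arc_count r F ys \<le> r" if "ys \<in> ?P" for ys
    using that two_r r2 by (intro arc_count_le) (auto simp: permutations_of_set_def distinct_card)
  have "card V * ((card V - 1) choose (r - 1)) = r * (card V choose r)"
    using binomial_absorption[of "r - 1" "card V"] r2 two_r by (simp add: Suc_diff_Suc)
  then have "(\<Sum>ys\<in>?P. arc_count r F ys) = r * (fact r * fact (card V - r) * (card V choose r))"
    unfolding sum_arc_count[OF finV uniform] size by (metis mult.assoc mult.commute)
  also have "fact r * fact (card V - r) * (card V choose r) = fact (card V)"
    using two_r by (intro binomial_fact_lemma) simp
  finally have "(\<Sum>ys\<in>?P. arc_count r F ys) = (\<Sum>ys\<in>?P. r)"
    using finV by (simp add: mult.commute)
  then show ?thesis
    using sum_mono_inv[of "arc_count r F" ?P "\<lambda>_. r" xs] le assms by auto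
qed

lemma arc_iff_not_opposite:
  assumes "xs \<in> permutations_of_set V" "arc r xs 0 \<in> F" "0 < i" "i < r"
  shows "arc r xs i \<in> F \<longleftrightarrow> arc r xs (card V + i - r) \<notin> F"
proof -
  have xs: "distinct xs" "length xs = card V"
    using assms by (auto simp: permutations_of_set_def distinct_card)
  show ?thesis
    using opposite_arcs[of xs i] arcs_through_zero(2)[of xs i] arc_count_eq[OF assms(1)] xs assms
      two_r r2 by auto
qed

text \<open>Not all arcs are members, so going round the cycle some member arc is followed by a
  nonmember. The opposite of that nonmember is then a member; it consists of the last
  \<open>r - 1\<close> positions and position 0, and shares only the latter with the member arc at
  0.\<close>

lemma exists_pair_meeting_once: "\<exists>A\<in>F. \<exists>B\<in>F. \<exists>x. A \<inter> B = {x}"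
proof -
  obtain xs where xs: "xs \<in> permutations_of_set V"
    using finV by (metis permutations_of_set_empty_iff ex_in_conv)
  then have len: "length xs = card V" and dist: "distinct xs"
    by (auto simp: permutations_of_set_def distinct_card)
  have "{j. j < length xs \<and> arc r xs j \<in> F} \<noteq> {}"
    using arc_count_eq[OF xs] r2 unfolding arc_count_card by (metis card.empty not_numeral_le_zero)
  then obtain j0 where j0: "arc r xs j0 \<in> F" by auto
  have "\<exists>j. arc r xs j \<in> F \<and> arc r xs (Suc j) \<notin> F"
  proof (rule ccontr)
    assume "\<not> ?thesis"
    then have up: "arc r xs (j0 + k) \<in> F" for k
      by (induction k) (use j0 in auto)
    have "arc r xs k \<in> F" for k
    proof -
      \<comment> \<open>Every position is reached from \<open>j0\<close> by going forward:
        \<open>length xs * j0 + k\<close> agrees with \<open>k\<close> modulo the length and is at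
        least \<open>j0\<close>.\<close>
      have "arc r xs (j0 + (length xs * j0 + k - j0)) = arc r xs k"
      proof -
        have "1 * j0 \<le> length xs * j0" using len two_r by (intro mult_right_mono) auto
        then have "j0 + (length xs * j0 + k - j0) = length xs * j0 + k" by linarith
        then show ?thesis unfolding arc_def
          by (metis mod_mult_self4 rotate_conv_mod)
      qed
      then show ?thesis using up by metis
    qed
    then have "arc_count r F xs = length xs" by (simp add: arc_count_def)
    then show False using arc_count_eq[OF xs] len two_r by simp
  qed
  then obtain j where j: "arc r xs j \<in> F" "arc r xs (Suc j) \<notin> F" by auto
  define ys where "ys = rotate j xs"
  have ys: "ys \<in> permutations_of_set V" "length ys = card V" "distinct ys"
    using xs len dist by (auto simp: ys_def permutations_of_set_def)
  have a0: "arc r ys 0 \<in> F" and a1: "arc r ys 1 \<notin> F" using j by (auto simp: ys_def arc_rotate)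
  have a2: "arc r ys (card V + 1 - r) \<in> F"
    using arc_iff_not_opposite[OF ys(1) a0, of 1] a1 r2 by auto
  let ?k = "card V + 1 - r"
  have "rotate ?k ys = drop ?k ys @ take ?k ys"
    using two_r r2 ys(2) by (simp add: rotate_drop_take)
  then have "take r (rotate ?k ys) = drop ?k ys @ take 1 ys"
    using ys(2) two_r r2 by (auto simp: min_def)
  then have B: "arc r ys ?k = set (drop ?k ys) \<union> set (take 1 ys)" by (simp add: arc_def)
  have "set (take r ys) \<inter> set (drop ?k ys) = {}"
    using ys(3) two_r by (intro set_take_disj_set_drop_if_distinct) auto
  moreover have "set (take 1 ys) = {hd ys}" "set (take 1 ys) \<subseteq> set (take r ys)"
  proof -
    show "set (take 1 ys) = {hd ys}" using ys(2) two_r by (cases ys) auto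
    show "set (take 1 ys) \<subseteq> set (take r ys)" using r2 by (intro set_take_subset_set_take) auto
  qed
  ultimately have "arc r ys 0 \<inter> arc r ys ?k = {hd ys}" unfolding B by (auto simp: arc_def)
  then show ?thesis using a0 a2 by blast
qed

text \<open>Line the points up cyclically as \<open>A - {x}\<close>, \<open>x\<close>,
  \<open>B - {x, b}\<close>, then \<open>b\<close> and \<open>y\<close> in either order, the rest,
  and a spare point \<open>z\<close>. In both orders the arc starting at \<open>x\<close> has the
  same opposite, \<open>insert z (A - {x})\<close>. With \<open>b\<close> first the arc is
  \<open>B\<close>, a member; hence the opposite is not, and with \<open>y\<close> first the arc
  must be a member too.\<close>

lemma exchange:
  assumes AB: "A \<in> F" "B \<in> F" "A \<inter> B = {x}" and b: "b \<in> B" "b \<noteq> x" and y: "y \<in> V" "y \<notin> A \<union> B"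
  shows "insert y (B - {b}) \<in> F"
proof -
  have A: "A \<subseteq> V" "card A = r" "finite A" and B: "B \<subseteq> V" "card B = r" "finite B"
    using member[OF AB(1)] member[OF AB(2)] by auto
  have xAB: "x \<in> A" "x \<in> B" using AB by auto
  have "card (A \<union> B) = 2 * r - 1"
    using card_Un_Int[of A B] A B AB r2 by simp
  then have cU: "card (insert y (A \<union> B)) = 2 * r" using y A B r2 by simp
  have "insert y (A \<union> B) \<noteq> V" using cU two_r by auto
  then obtain z where z: "z \<in> V" "z \<notin> insert y (A \<union> B)" using y A B by blast
  obtain As where As: "set As = A - {x}" "distinct As"
    using finite_distinct_list[of "A - {x}"] A by auto
  obtain Bs where Bs: "set Bs = B - {x, b}" "distinct Bs"
    using finite_distinct_list[of "B - {x, b}"] B by auto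
  obtain Rs where Rs: "set Rs = V - (A \<union> B) - {y, z}" "distinct Rs"
    using finite_distinct_list[of "V - (A \<union> B) - {y, z}"] finV by auto
  have lA: "length As = r - 1" using As A xAB distinct_card[of As] by simp
  have lB: "length Bs = r - 2" using Bs B xAB b distinct_card[of Bs] by simp
  have key: "insert u ({x} \<union> set Bs) \<in> F \<longleftrightarrow> insert z (set As) \<notin> F" if uv: "{u, v} = {b, y}" for u v
  proof -
    let ?xs = "As @ [x] @ Bs @ [u] @ [v] @ Rs @ [z]"
    have "u = b \<and> v = y \<or> u = y \<and> v = b" using uv by (simp only: doubleton_eq_iff)
    then have d: "distinct ?xs"
      using As(2) Bs(2) Rs(2) AB(3) b y z by (elim disjE conjE; simp add: As(1) Bs(1) Rs(1); blast)
    have "set ?xs = (A - {x}) \<union> {x} \<union> (B - {x, b}) \<union> {u, v} \<union> (V - (A \<union> B) - {y, z}) \<union> {z}"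
      using As Bs Rs by auto
    also have "\<dots> = V" unfolding uv using A B b y z xAB by blast
    finally have P: "?xs \<in> permutations_of_set V" and len: "length ?xs = card V"
      using d distinct_card[OF d] by (auto simp: permutations_of_set_def simp del: set_append distinct_append)
    have a0: "arc r ?xs 0 = A" using As lA r2 xAB by (auto simp: arc_def)
    have "rotate (r - 1) ?xs = ([x] @ Bs @ [u] @ [v] @ Rs @ [z]) @ As"
      using rotate_append[of As] lA by metis
    then have a1: "arc r ?xs (r - 1) = insert u ({x} \<union> set Bs)"
      using lB r2 by (auto simp: arc_def take_Cons' )
    have "length (As @ [x] @ Bs @ [u] @ [v] @ Rs) = card V - 1" using len by simp
    then have "rotate (card V - 1) ?xs = [z] @ (As @ [x] @ Bs @ [u] @ [v] @ Rs)"
      using rotate_append[of "As @ [x] @ Bs @ [u] @ [v] @ Rs" "[z]"] by simp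
    then have a2: "arc r ?xs (card V - 1) = insert z (set As)"
      using lA r2 by (auto simp: arc_def take_Cons')
    have eq: "card V + (r - 1) - r = card V - 1" using r2 two_r by simp
    have "arc r ?xs (r - 1) \<in> F \<longleftrightarrow> arc r ?xs (card V + (r - 1) - r) \<notin> F"
      by (rule arc_iff_not_opposite[OF P]) (use a0 AB r2 in auto)
    then show ?thesis unfolding eq a1 a2 .
  qed
  have "insert b ({x} \<union> set Bs) = B" using Bs b xAB by auto
  then have "insert y ({x} \<union> set Bs) \<in> F" using key[of b y] key[of y b] AB by auto
  moreover have "insert y ({x} \<union> set Bs) = insert y (B - {b})" using Bs b xAB by auto
  ultimately show ?thesis by simp
qed

text \<open>Each exchange moves \<open>B\<close> one point closer to \<open>G\<close>. The incoming
  point \<open>g\<close> has to lie outside \<open>A\<close>, so if necessary it is first exchanged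
  out of \<open>A\<close> for a point outside \<open>A \<union> B\<close>; the set \<open>A\<close>
  is carried along as a witness for the single common point.\<close>

lemma exchange_to:
  assumes "A \<in> F" "B \<in> F" "A \<inter> B = {x}" "G \<subseteq> V" "card G = r" "x \<in> G"
  shows "G \<in> F"
  using assms
proof (induction "card (G - B)" arbitrary: A B)
  case 0
  have "finite (G - B)" using 0 finV by (auto dest: finite_subset)
  then have "G \<subseteq> B" using 0 by auto
  then have "G = B" using 0 member[of B] by (intro card_subset_eq) auto
  then show ?case using 0 by simp
next
  case (Suc k)
  have A: "A \<subseteq> V" "card A = r" "finite A" and B: "B \<subseteq> V" "card B = r" "finite B" and fG: "finite G"
    using member[OF Suc.prems(1)] member[OF Suc.prems(2)] Suc.prems(4) finV
    by (auto dest: finite_subset)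
  have xAB: "x \<in> A" "x \<in> B" using Suc.prems by auto
  obtain g where g: "g \<in> G" "g \<notin> B" using Suc.hyps(2) by (metis Diff_iff card.empty equals0I nat.distinct(1))
  have "card (G - B) = card (B - G)"
    using card_Diff_subset_Int[of G B] card_Diff_subset_Int[of B G] B Suc.prems fG
    by (simp add: Int_commute)
  then obtain b where b: "b \<in> B" "b \<notin> G"
    using Suc.hyps(2) by (metis Diff_iff card.empty equals0I nat.distinct(1))
  have bx: "b \<noteq> x" and gx: "g \<noteq> x" using b g Suc.prems by auto
  have "\<exists>A'\<in>F. A' \<inter> B = {x} \<and> g \<notin> A'"
  proof (cases "g \<in> A")
    case True
    have "card (A \<union> B) = 2 * r - 1"
      using card_Un_Int[of A B] A B Suc.prems r2 by simp
    then have "A \<union> B \<noteq> V" using two_r by auto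
    then obtain y where y: "y \<in> V" "y \<notin> A \<union> B" using A B by blast
    have "insert y (A - {g}) \<in> F"
      using Suc.prems gx y True exchange[of B A x g y] by auto
    moreover have "insert y (A - {g}) \<inter> B = {x}" using Suc.prems(3) y gx by auto
    moreover have "g \<notin> insert y (A - {g})" using y True by auto
    ultimately show ?thesis by blast
  next
    case False
    then show ?thesis using Suc.prems by auto
  qed
  then obtain A' where A': "A' \<in> F" "A' \<inter> B = {x}" "g \<notin> A'" by blast
  define B' where "B' = insert g (B - {b})"
  have B': "B' \<in> F" unfolding B'_def using A' Suc.prems b bx g by (intro exchange) auto
  have "A' \<inter> B' = {x}" using A' bx by (auto simp: B'_def)
  moreover have "k = card (G - B')"
  proof -
    have "G - B' = (G - B) - {g}" using b by (auto simp: B'_def)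
    then show ?thesis using Suc.hyps(2) g fG by simp
  qed
  ultimately show ?case using Suc.hyps(1)[of B' A'] A' B' Suc.prems by auto
qed

text \<open>\<open>exchange_to\<close> puts the full star at \<open>x\<close> inside
  \<open>F\<close>, and both have the same size.\<close>

lemma extremal_is_star: "\<exists>x\<in>V. \<forall>e\<in>F. x \<in> e"
proof -
  obtain A B x where ABx: "A \<in> F" "B \<in> F" "A \<inter> B = {x}" using exists_pair_meeting_once by blast
  then have xV: "x \<in> V" using uniform by auto
  let ?S = "{e. e \<subseteq> V \<and> card e = r \<and> x \<in> e}"
  have sub: "?S \<subseteq> F" using exchange_to[OF ABx] by auto
  have finF: "finite F" by (rule finite_subset[of _ "Pow V"]) (use uniform finV in auto)
  have "bij_betw (insert x) {e. e \<subseteq> V - {x} \<and> card e = r - 1} ?S"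
  proof (rule bij_betwI[where g = "\<lambda>e. e - {x}"], goal_cases)
    case 1
    have "card (insert x e) = r" if "e \<subseteq> V - {x}" "card e = r - 1" for e
    proof -
      have "finite e" "x \<notin> e" using that finV finite_subset by auto
      then show ?thesis using that r2 by simp
    qed
    then show ?case using xV by auto
  next
    case 2
    then show ?case by (auto intro: card_Diff_singleton)
  qed auto
  then have "card ?S = card {e. e \<subseteq> V - {x} \<and> card e = r - 1}"
    by (simp add: bij_betw_same_card)
  also have "\<dots> = (card V - 1) choose (r - 1)"
    using n_subsets[of "V - {x}" "r - 1"] finV xV by simp
  finally have "?S = F" using sub finF size by (intro card_subset_eq) auto
  then show ?thesis using xV by auto
qed

end

section \<open>Binomial estimates\<close>

text \<open>Each factor \<open>(K - j) / (M - j)\<close> of the ratio of the binomials is at most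
  \<open>K / M\<close>; multiplied out to stay in the natural numbers.\<close>

lemma binomial_ratio_power:
  fixes K M i :: nat
  assumes "K \<le> M"
  shows "(K choose i) * M ^ i \<le> (M choose i) * K ^ i"
proof (induction i)
  case (Suc i)
  have step: "Suc i * (m choose Suc i) = (m choose i) * (m - i)" for m :: nat
    by (metis binomial_absorb_comp binomial_absorption mult.commute)
  have "(K - i) * M \<le> (M - i) * K"
    using assms by (cases "i \<le> K") (auto simp: diff_mult_distrib mult.commute[of K M] intro!: diff_le_mono2 mult_le_mono)
  then have "((K choose i) * M ^ i) * ((K - i) * M) \<le> ((M choose i) * K ^ i) * ((M - i) * K)"
    by (rule mult_le_mono[OF Suc])
  then have "Suc i * ((K choose Suc i) * M ^ Suc i) \<le> Suc i * ((M choose Suc i) * K ^ Suc i)"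
    using step[of K] step[of M] by (simp only: power_Suc mult.assoc[symmetric]) (simp add: ac_simps)
  then show ?case by (simp only: mult_le_cancel1 zero_less_Suc simp_thms)
qed simp

text \<open>The ratio is the probability that a uniform \<open>r\<close>-subset of \<open>m\<close>
  points avoids \<open>s\<close> given points; the factors come from drawing one point at a
  time.\<close>

lemma binomial_ratio_prod:
  fixes m s r :: nat
  assumes "s + r \<le> m"
  shows "real ((m - s) choose r) / real (m choose r) = (\<Prod>i<r. 1 - real s / (real m - real i))"
proof -
  have "real ((m - s) choose r) / real (m choose r) =
     (\<Prod>i = 0..<r. (real (m - s - i) / real (r - i)) / (real (m - i) / real (r - i)))"
    using assms by (simp add: binomial_altdef_of_nat prod_dividef)
  also have "\<dots> = (\<Prod>i<r. 1 - real s / (real m - real i))"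
    unfolding atLeast0LessThan
  proof (rule prod.cong)
    fix i assume "i \<in> {..<r}"
    then have e: "real (m - s - i) = real m - real i - real s" "real (m - i) = real m - real i"
      and z: "real m - real i \<noteq> 0" "real (r - i) \<noteq> 0"
      using assms by auto
    have "((x - y) / c) / (x / c) = 1 - y / x" if "x \<noteq> 0" "c \<noteq> 0" for x y c :: real
      using that by (simp add: field_simps)
    from this[OF z] show "(real (m - s - i) / real (r - i)) / (real (m - i) / real (r - i)) = 1 - real s / (real m - real i)"
      unfolding e .
  qed simp
  finally show ?thesis .
qed

lemma binomial_ratio_le_exp:
  fixes m s r :: nat
  assumes "s + r \<le> m"
  shows "real ((m - s) choose r) / real (m choose r) \<le> exp (- (real r * real s / real m))"
proof -
  have "(\<Prod>i<r. 1 - real s / (real m - real i)) \<le> (\<Prod>i<r. exp (- (real s / real m)))"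
  proof (rule prod_mono, rule conjI)
    fix i assume "i \<in> {..<r}"
    then have i: "0 < real m - real i" "real s \<le> real m - real i" "real m - real i \<le> real m"
      using assms by auto
    then show "0 \<le> 1 - real s / (real m - real i)" by simp
    have "1 - real s / (real m - real i) \<le> 1 + - (real s / real m)"
      using i by (simp add: frac_le)
    also have "\<dots> \<le> exp (- (real s / real m))" by (rule exp_ge_add_one_self)
    finally show "1 - real s / (real m - real i) \<le> exp (- (real s / real m))" .
  qed
  also have "\<dots> = exp (- (real r * real s / real m))"
    by (simp add: exp_of_nat_mult[symmetric])
  finally show ?thesis using binomial_ratio_prod[OF assms] by simp
qed

text \<open>All factors lie between 0 and 1, so the product falls short of 1 by at most the sum of
  their shortfalls.\<close>

lemma binomial_ratio_ge:
  fixes m s r :: nat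
  assumes "s + r \<le> m" "r < m"
  shows "1 - real r * (real s / (real m - real r)) \<le> real ((m - s) choose r) / real (m choose r)"
proof -
  have "norm ((\<Prod>i<r. 1) - (\<Prod>i<r. 1 - real s / (real m - real i)))
     \<le> (\<Sum>i<r. norm (1 - (1 - real s / (real m - real i))))"
    using assms by (intro norm_prod_diff) auto
  also have "\<dots> \<le> (\<Sum>i<r. real s / (real m - real r))"
    using assms by (intro sum_mono) (auto intro!: divide_left_mono)
  finally show ?thesis using binomial_ratio_prod[OF assms(1)] by (simp add: abs_le_iff)
qed

text \<open>\<open>u\<close> is the probability of avoiding one \<open>s\<close>-set and
  \<open>v\<close> that of avoiding two disjoint ones. Factor by factor
  \<open>(1 - t)^2 - (1 - 2 * t) = t^2\<close>, and these errors add up. The use is in writing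
  \<open>1 - 2 * u + v\<close>, the probability of meeting both, as
  \<open>(1 - u)^2 - (u^2 - v)\<close>.\<close>

lemma binomial_ratio_square_diff:
  fixes m s r :: nat
  assumes "2 * s + r \<le> m" "r < m"
  defines "u \<equiv> real ((m - s) choose r) / real (m choose r)"
    and "v \<equiv> real ((m - 2 * s) choose r) / real (m choose r)"
  shows "v \<le> u\<^sup>2" "u\<^sup>2 - v \<le> real r * (real s / (real m - real r))\<^sup>2"
proof -
  have u: "u\<^sup>2 = (\<Prod>i<r. (1 - real s / (real m - real i))\<^sup>2)"
    using binomial_ratio_prod[of s r m] assms by (simp add: prod_power_distrib)
  have v: "v = (\<Prod>i<r. 1 - real (2 * s) / (real m - real i))"
    unfolding v_def using assms by (intro binomial_ratio_prod)
  have sq: "(1 - real s / (real m - real i))\<^sup>2 - (1 - real (2 * s) / (real m - real i)) = (real s / (real m - real i))\<^sup>2" for i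
    by (simp add: power2_eq_square algebra_simps)
  have i: "real (2 * s) / (real m - real i) \<le> 1" "0 \<le> real (2 * s) / (real m - real i)"
    "0 \<le> real s / (real m - real i)" "real s / (real m - real i) \<le> 1"
    "real s / (real m - real i) \<le> real s / (real m - real r)" if "i < r" for i
    using assms that by (auto intro!: divide_left_mono)
  show "v \<le> u\<^sup>2" unfolding u v
  proof (rule prod_mono)
    fix i assume "i \<in> {..<r}"
    then show "0 \<le> 1 - real (2 * s) / (real m - real i) \<and>
       1 - real (2 * s) / (real m - real i) \<le> (1 - real s / (real m - real i))\<^sup>2"
      using i[of i] sq[of i] zero_le_power2[of "real s / (real m - real i)"]
      unfolding lessThan_iff by linarith
  qed
  have "norm (u\<^sup>2 - v) \<le> (\<Sum>i<r. norm ((1 - real s / (real m - real i))\<^sup>2 - (1 - real (2 * s) / (real m - real i))))"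
    unfolding u v
  proof (rule norm_prod_diff)
    fix j assume j: "j \<in> {..<r}"
    show "norm ((1 - real s / (real m - real j))\<^sup>2) \<le> 1"
      using i[of j] j by (auto intro!: power_le_one)
    show "norm (1 - real (2 * s) / (real m - real j)) \<le> 1"
      using i[of j] j by auto
  qed
  also have "\<dots> \<le> (\<Sum>i<r. (real s / (real m - real r))\<^sup>2)"
    unfolding sq using i by (intro sum_mono) (auto intro!: power_mono)
  finally show "u\<^sup>2 - v \<le> real r * (real s / (real m - real r))\<^sup>2" by simp
qed

lemma one_minus_exp_ge:
  fixes y :: real
  assumes "0 \<le> y" shows "y / (1 + y) \<le> 1 - exp (- y)"
proof -
  have "exp (- y) \<le> 1 / (1 + y)"
    using assms exp_ge_add_one_self[of y] by (simp add: exp_minus field_simps)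
  moreover have "y / (1 + y) = 1 - 1 / (1 + y)" using assms by (simp add: field_simps)
  ultimately show ?thesis by simp
qed

lemma two_power_le_binomial:
  assumes "2 * k \<le> m" shows "2 ^ k \<le> real (m choose k)"
proof (cases "k = 0")
  case False
  have "2 ^ k \<le> (real m / real k) ^ k"
    using assms False by (intro power_mono) (auto simp: field_simps)
  also have "\<dots> \<le> real (m choose k)"
    using binomial_ge_n_over_k_pow_k[of k m, where 'a = real] assms by simp
  finally show ?thesis .
qed simp

text \<open>Since \<open>k \<le> 2 ^ (k - 1) \<le> (m / k) ^ (k - 1)\<close>, multiplying by
  \<open>m / k\<close> gives \<open>m \<le> (m / k) ^ k\<close>.\<close>

lemma le_binomial:
  assumes "1 \<le> k" "2 * k \<le> m" shows "m \<le> m choose k"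
proof -
  have "real k \<le> 2 ^ (k - 1)"
  proof -
    have "Suc (k - 1) \<le> 2 ^ (k - 1)" using less_exp[of "k - 1"] by (rule Suc_leI)
    then have "real (Suc (k - 1)) \<le> real (2 ^ (k - 1))" by (simp only: of_nat_le_iff)
    then show ?thesis using assms(1) by simp
  qed
  then have "real m \<le> real m / real k * 2 ^ (k - 1)"
    using assms by (simp add: field_simps mult_left_mono)
  also have "\<dots> \<le> real m / real k * (real m / real k) ^ (k - 1)"
    using assms by (intro mult_left_mono power_mono) (auto simp: field_simps)
  also have "\<dots> = (real m / real k) ^ k"
    using assms by (metis Suc_diff_le diff_Suc_1 plus_1_eq_Suc le_add_diff_inverse power_Suc)
  also have "\<dots> \<le> real (m choose k)"
    using binomial_ge_n_over_k_pow_k[of k m, where 'a = real] assms by simp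
  finally show ?thesis by simp
qed

section \<open>The process and its stars\<close>

text \<open>The state after \<open>k\<close> rounds. A halted process keeps its family, which may
  then have fewer than \<open>k\<close> members.\<close>

definition proc :: "nat \<Rightarrow> nat \<Rightarrow> nat \<Rightarrow> nat set set pmf" where
  "proc n r k = ((\<lambda>p. bind_pmf p (step n r)) ^^ k) (return_pmf {})"

definition Star :: "nat \<Rightarrow> nat \<Rightarrow> nat \<Rightarrow> nat set set" where
  "Star n r x = {e \<in> rsets n r. x \<in> e}"

definition is_star :: "nat \<Rightarrow> nat set set \<Rightarrow> bool" where
  "is_star n F \<longleftrightarrow> (\<exists>x\<in>{1..n}. \<forall>e\<in>F. x \<in> e)"

text \<open>The \<open>r\<close>-sets that can still destroy a star \<open>F\<close> centred at
  \<open>x\<close>.\<close>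

definition hitting :: "nat \<Rightarrow> nat \<Rightarrow> nat \<Rightarrow> nat set set \<Rightarrow> nat set set" where
  "hitting n r x F = {f \<in> rsets n r. x \<notin> f \<and> (\<forall>e\<in>F. f \<inter> e \<noteq> {})}"

lemma proc_0: "proc n r 0 = return_pmf {}"
  by (simp add: proc_def)

lemma proc_Suc: "proc n r (Suc k) = bind_pmf (proc n r k) (step n r)"
  by (simp add: proc_def)

lemma process_eq: "process n r = proc n r (card (rsets n r))"
  by (simp add: process_def proc_def)

lemma prob_bind_finite:
  assumes "finite U" "set_pmf p \<subseteq> U"
  shows "measure_pmf.prob (bind_pmf p f) A = (\<Sum>x\<in>U. pmf p x * measure_pmf.prob (f x) A)"
proof -
  have "measure_pmf.prob (bind_pmf p f) A = (\<integral>x. measure_pmf.prob (f x) A \<partial>measure_pmf p)"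
    unfolding measure_pmf_bind
    by (subst measure_pmf.measure_bind[where N = "count_space UNIV"]) (auto simp: measure_subprob)
  also have "\<dots> = (\<Sum>x\<in>U. measure_pmf.prob (f x) A * pmf p x)"
    using assms by (intro integral_measure_pmf_real) auto
  finally show ?thesis by (simp add: mult.commute)
qed

section \<open>Sizes of families of \<open>r\<close>-sets and one step of the process\<close>

lemma finite_rsets [simp]: "finite (rsets n r)"
  by (rule finite_subset[of _ "Pow {1..n}"]) (auto simp: rsets_def)

lemma finite_avail [simp]: "finite (avail n r F)"
  by (rule finite_subset[of _ "rsets n r"]) (auto simp: avail_def)

lemma finite_Star [simp]: "finite (Star n r x)"
  by (rule finite_subset[of _ "rsets n r"]) (auto simp: Star_def)

lemma finite_hitting [simp]: "finite (hitting n r x F)"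
  by (rule finite_subset[of _ "rsets n r"]) (auto simp: hitting_def)

lemma rsetsD: "e \<in> rsets n r \<Longrightarrow> e \<subseteq> {1..n} \<and> card e = r \<and> finite e"
  by (auto simp: rsets_def dest: finite_subset)

lemma card_rsets: "card (rsets n r) = n choose r"
  using n_subsets[of "{1..n}" r] by (simp add: rsets_def)

lemma card_rsets_avoiding:
  assumes "X \<subseteq> {1..n}"
  shows "card {e \<in> rsets n r. e \<inter> X = {}} = (n - card X) choose r"
proof -
  have "{e \<in> rsets n r. e \<inter> X = {}} = {e. e \<subseteq> {1..n} - X \<and> card e = r}"
    by (auto simp: rsets_def)
  then show ?thesis
    using n_subsets[of "{1..n} - X" r] assms by (simp add: card_Diff_subset finite_subset)
qed

lemma card_rsets_containing:
  assumes "X \<subseteq> {1..n}" "card X \<le> r"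
  shows "card {e \<in> rsets n r. X \<subseteq> e} = (n - card X) choose (r - card X)"
proof -
  have fX: "finite X" using assms finite_subset by auto
  have "bij_betw (\<lambda>e. e \<union> X) {e. e \<subseteq> {1..n} - X \<and> card e = r - card X} {e \<in> rsets n r. X \<subseteq> e}"
  proof (rule bij_betwI[where g = "\<lambda>e. e - X"], goal_cases)
    case 1
    have "card (e \<union> X) = r" if "e \<subseteq> {1..n} - X" "card e = r - card X" for e
    proof -
      have "finite e" "e \<inter> X = {}" using that finite_subset[of e "{1..n} - X"] by auto
      then show ?thesis using that assms fX by (simp add: card_Un_disjoint)
    qed
    then show ?case using assms by (auto simp: rsets_def)
  next
    case 2
    then show ?case using fX by (auto simp: rsets_def card_Diff_subset)
  qed auto
  then show ?thesis
    using bij_betw_same_card n_subsets[of "{1..n} - X" "r - card X"] assms fX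
    by (fastforce simp: card_Diff_subset)
qed

lemma card_Star:
  assumes "x \<in> {1..n}" "1 \<le> r"
  shows "card (Star n r x) = (n - 1) choose (r - 1)"
  using card_rsets_containing[of "{x}" n r] assms by (simp add: Star_def)

lemma prob_step:
  assumes "avail n r F \<noteq> {}"
  shows "measure_pmf.prob (step n r F) A = card {e \<in> avail n r F. insert e F \<in> A} / card (avail n r F)"
proof -
  have "avail n r F \<inter> (\<lambda>e. insert e F) -` A = {e \<in> avail n r F. insert e F \<in> A}" by auto
  then show ?thesis using assms by (simp add: step_def measure_pmf_of_set)
qed

lemma prob_step_halted:
  assumes "avail n r F = {}"
  shows "measure_pmf.prob (step n r F) A = indicator A F"
  using assms by (simp add: step_def)

locale intersecting_process =
  fixes n r :: nat
  assumes r1: "1 \<le> r" and rn: "2 * r < n"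
begin

abbreviation "N \<equiv> n choose r"
abbreviation "M \<equiv> (n - 1) choose (r - 1)"
abbreviation "P k \<equiv> measure_pmf.prob (proc n r k)"

lemma M_pos: "0 < M" using rn by auto

lemma M_le_N: "M \<le> N"
  using card_Star[of 1 n r] card_mono[of "rsets n r" "Star n r 1"] r1 rn
  by (auto simp: card_rsets Star_def)

lemma proc_invariant:
  assumes "F \<in> set_pmf (proc n r k)"
  shows "F \<subseteq> rsets n r \<and> (\<forall>e\<in>F. \<forall>f\<in>F. e \<inter> f \<noteq> {}) \<and> card F \<le> k \<and> (avail n r F = {} \<or> card F = k)"
  using assms
proof (induction k arbitrary: F)
  case 0
  then show ?case by (simp add: proc_0)
next
  case (Suc k)
  then obtain G where G: "G \<in> set_pmf (proc n r k)" "F \<in> set_pmf (step n r G)"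
    by (auto simp: proc_Suc)
  note IH = Suc.IH[OF G(1)]
  show ?case
  proof (cases "avail n r G = {}")
    case True
    then have "F = G" using G by (simp add: step_def)
    then show ?thesis using IH True by auto
  next
    case False
    then obtain e where e: "e \<in> avail n r G" "F = insert e G"
      using G by (auto simp: step_def)
    have fG: "finite G" using IH finite_subset[of G "rsets n r"] by simp
    have eR: "e \<in> rsets n r" "e \<notin> G" and eG: "\<forall>f\<in>G. e \<inter> f \<noteq> {}" using e(1) by (auto simp: avail_def)
    have "e \<noteq> {}" using rsetsD[OF eR(1)] r1 by auto
    then have "\<forall>e\<in>F. \<forall>f\<in>F. e \<inter> f \<noteq> {}"
      unfolding e(2) using IH eG by (metis Int_absorb Int_commute insert_iff)
    moreover have "card F = Suc k" unfolding e(2) using eR IH False fG by simp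
    moreover have "F \<subseteq> rsets n r" unfolding e(2) using eR IH by simp
    ultimately show ?thesis by simp
  qed
qed

lemma set_proc: "set_pmf (proc n r k) \<subseteq> Pow (rsets n r)"
  using proc_invariant by blast

lemma proc_mem_finite: "F \<in> set_pmf (proc n r k) \<Longrightarrow> finite F"
  using proc_invariant[of F k] finite_subset[of F "rsets n r"] by simp

text \<open>Without halting, each of the \<open>card (rsets n r)\<close> rounds would add a set,
  which exhausts all \<open>r\<close>-sets.\<close>

lemma process_halted:
  assumes "F \<in> set_pmf (process n r)"
  shows "avail n r F = {}"
proof (rule ccontr)
  assume "avail n r F \<noteq> {}"
  with proc_invariant[OF assms[unfolded process_eq]]
  have "F \<subseteq> rsets n r" "card F = card (rsets n r)" by auto
  then have "F = rsets n r" by (intro card_subset_eq) auto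
  then show False using \<open>avail n r F \<noteq> {}\<close> by (auto simp: avail_def)
qed

section \<open>One-step recursion and events monotone along the process\<close>

lemma prob_proc_Suc:
  "P (Suc k) A = (\<Sum>F\<in>Pow (rsets n r). pmf (proc n r k) F * measure_pmf.prob (step n r F) A)"
  unfolding proc_Suc by (rule prob_bind_finite) (use set_proc in auto)

lemma prob_proc_sum: "P k A = (\<Sum>F\<in>Pow (rsets n r). pmf (proc n r k) F * indicator A F)"
proof -
  have "P k A = P k (A \<inter> Pow (rsets n r))"
    using set_proc[of k] by (intro measure_prob_cong_0) (auto simp: pmf_eq_0_set_pmf)
  also have "\<dots> = sum (pmf (proc n r k)) (A \<inter> Pow (rsets n r))"
    by (intro measure_measure_pmf_finite) auto
  also have "\<dots> = (\<Sum>F\<in>Pow (rsets n r). pmf (proc n r k) F * indicator A F)"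
    by (subst Int_commute) (simp add: sum.inter_restrict indicator_def if_distrib cong: if_cong)
  finally show ?thesis .
qed

lemma prob_proc_Suc_le:
  assumes "\<And>F. F \<in> set_pmf (proc n r k) \<Longrightarrow> measure_pmf.prob (step n r F) A \<le> indicator B F"
  shows "P (Suc k) A \<le> P k B"
  unfolding prob_proc_Suc prob_proc_sum[of k]
proof (rule sum_mono)
  fix F
  show "pmf (proc n r k) F * measure_pmf.prob (step n r F) A \<le> pmf (proc n r k) F * indicator B F"
    using assms[of F] by (cases "F \<in> set_pmf (proc n r k)") (auto simp: set_pmf_iff intro: mult_left_mono)
qed

lemma prob_proc_Suc_ge:
  assumes "\<And>F e. F \<in> set_pmf (proc n r k) \<Longrightarrow> F \<in> A \<Longrightarrow> e \<in> avail n r F \<Longrightarrow> insert e F \<in> A"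
  shows "P k A \<le> P (Suc k) A"
  unfolding prob_proc_Suc prob_proc_sum[of k]
proof (rule sum_mono)
  fix F
  have "indicator A F \<le> measure_pmf.prob (step n r F) A" if F: "F \<in> set_pmf (proc n r k)"
  proof (cases "F \<in> A \<and> avail n r F \<noteq> {}")
    case True
    then have "{e \<in> avail n r F. insert e F \<in> A} = avail n r F" using assms[OF F] by auto
    then show ?thesis using True by (auto simp: prob_step)
  next
    case False
    then show ?thesis by (auto simp: prob_step_halted indicator_def)
  qed
  then show "pmf (proc n r k) F * indicator A F \<le> pmf (proc n r k) F * measure_pmf.prob (step n r F) A"
    by (cases "F \<in> set_pmf (proc n r k)") (auto simp: set_pmf_iff intro: mult_left_mono)
qed

lemma star_decreasing:
  assumes "j \<le> k" shows "P k {F. is_star n F} \<le> P j {F. is_star n F}"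
  using assms
proof (induction rule: dec_induct)
  case (step k)
  have "P (Suc k) {F. is_star n F} \<le> P k {F. is_star n F}"
  proof (rule prob_proc_Suc_le)
    fix F
    show "measure_pmf.prob (Defs.step n r F) {F. is_star n F} \<le> indicator {F. is_star n F} F"
    proof (cases "is_star n F")
      case False
      then have "\<not> is_star n (insert e F)" for e by (auto simp: is_star_def)
      then show ?thesis using False by (cases "avail n r F = {}") (auto simp: prob_step prob_step_halted)
    qed simp
  qed
  then show ?case using step by simp
qed simp

text \<open>A final family of size \<open>M\<close> is a star by Erdos-Ko-Rado uniqueness, and a
  star at the end was a star at every earlier time, so any convenient \<open>k\<close> gives an
  upper bound.\<close>

lemma probE_le_star:
  assumes "2 \<le> r" "k \<le> N"
  shows "probE n r \<le> P k {F. is_star n F}"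
proof -
  have "probE n r \<le> P N {F. is_star n F}"
    unfolding probE_def process_eq card_rsets
  proof (rule measure_pmf.finite_measure_mono_AE)
    have "card F = M \<longrightarrow> is_star n F" if "F \<in> set_pmf (proc n r N)" for F
    proof
      assume "card F = M"
      with proc_invariant[OF that] assms rn have "extremal_family F r {1..n}"
        by unfold_locales (auto simp: rsets_def)
      then show "is_star n F" using extremal_family.extremal_is_star by (auto simp: is_star_def)
    qed
    then show "AE F in proc n r N. F \<in> {F. card F = M} \<longrightarrow> F \<in> {F. is_star n F}"
      by (auto simp: AE_measure_pmf_iff)
  qed simp
  also have "\<dots> \<le> P k {F. is_star n F}" using assms(2) by (rule star_decreasing)
  finally show ?thesis .
qed

lemma Star_diff_subset_avail: "F \<subseteq> Star n r x \<Longrightarrow> Star n r x - F \<subseteq> avail n r F"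
  by (auto simp: Star_def avail_def)

lemma card_avail_star:
  assumes "x \<in> {1..n}" "F \<subseteq> Star n r x"
  shows "M - card F \<le> card (avail n r F)"
proof -
  have "M - card F = card (Star n r x - F)"
    using assms card_Star[OF assms(1) r1] by (simp add: card_Diff_subset finite_subset[OF assms(2)])
  also have "\<dots> \<le> card (avail n r F)"
    using Star_diff_subset_avail[OF assms(2)] by (intro card_mono) auto
  finally show ?thesis .
qed

text \<open>A star with fewer than \<open>M\<close> members can be extended inside the full star, so
  the process cannot have halted early.\<close>

lemma card_proc_star:
  assumes "F \<in> set_pmf (proc n r k)" "x \<in> {1..n}" "F \<subseteq> Star n r x" "k \<le> M"
  shows "card F = k"
proof (rule ccontr)
  assume "card F \<noteq> k"
  then have "avail n r F = {}" "card F < k" using proc_invariant[OF assms(1)] by auto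
  then show False using card_avail_star[OF assms(2,3)] assms(4) by simp
qed

section \<open>Probability of reaching a given subfamily of a star\<close>

lemma pmf_step_le:
  assumes "avail n r G \<noteq> {}"
  shows "pmf (step n r G) F \<le> 1 / card (avail n r G)"
proof -
  have "{e \<in> avail n r G. insert e G \<in> {F}} \<subseteq> {the_elem (F - G)}"
  proof
    fix e assume "e \<in> {e \<in> avail n r G. insert e G \<in> {F}}"
    then have "F - G = {e}" by (auto simp: avail_def)
    then show "e \<in> {the_elem (F - G)}" by simp
  qed
  then have "card {e \<in> avail n r G. insert e G \<in> {F}} \<le> 1"
    using card_mono[of "{the_elem (F - G)}"] by fastforce
  then show ?thesis
    unfolding measure_pmf_single[symmetric] prob_step[OF assms]
    by (intro divide_right_mono) auto
qed

text \<open>Condition on which member of \<open>F\<close> came last. The factor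
  \<open>fact k\<close> counts the orders of arrival, and in each order the choice made with
  \<open>i\<close> members present has probability at most \<open>1 / a i\<close>.\<close>

lemma pmf_proc_le:
  fixes a :: "nat \<Rightarrow> real"
  assumes "\<And>i G. i < k \<Longrightarrow> G \<subseteq> Star n r x \<Longrightarrow> card G = i \<Longrightarrow> a i \<le> card (avail n r G)"
    and "\<And>i. i < k \<Longrightarrow> 0 < a i"
    and "F \<subseteq> Star n r x" "card F = k"
  shows "pmf (proc n r k) F \<le> fact k * (\<Prod>i<k. 1 / a i)"
  using assms
proof (induction k arbitrary: F)
  case 0
  then show ?case by (simp add: pmf_le_1)
next
  case (Suc k)
  have fF: "finite F" using Suc.prems(3) by (rule finite_subset) simp
  have FR: "F \<subseteq> rsets n r" using Suc.prems(3) by (auto simp: Star_def)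
  let ?U = "Pow (rsets n r)" and ?D = "(\<lambda>e. F - {e}) ` F"
  have "pmf (proc n r (Suc k)) F = (\<Sum>G\<in>?U. pmf (proc n r k) G * pmf (step n r G) F)"
    using prob_proc_Suc[of k "{F}"] by (simp add: measure_pmf_single)
  also have "\<dots> = (\<Sum>G\<in>?D. pmf (proc n r k) G * pmf (step n r G) F)"
  \<comment> \<open>Only predecessors \<open>F - {e}\<close> contribute: a halted predecessor would
    be \<open>F\<close> itself, which has too many members for \<open>k\<close> rounds.\<close>
  proof (rule sum.mono_neutral_right)
    show "?D \<subseteq> ?U" using FR by auto
    show "\<forall>G\<in>?U - ?D. pmf (proc n r k) G * pmf (step n r G) F = 0"
    proof (rule ballI, rule ccontr)
      fix G assume G: "G \<in> ?U - ?D" and "pmf (proc n r k) G * pmf (step n r G) F \<noteq> 0"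
      then have *: "G \<in> set_pmf (proc n r k)" "F \<in> set_pmf (step n r G)" by (auto simp: set_pmf_iff)
      show False
      proof (cases "avail n r G = {}")
        case True
        then have "F = G" using * by (simp add: step_def)
        then show False using proc_invariant[OF *(1)] Suc.prems(4) by auto
      next
        case False
        then obtain e where "e \<in> avail n r G" "F = insert e G" using * by (auto simp: step_def)
        then have "G = F - {e}" "e \<in> F" by (auto simp: avail_def)
        then show False using G by auto
      qed
    qed
  qed simp
  also have "\<dots> = (\<Sum>e\<in>F. pmf (proc n r k) (F - {e}) * pmf (step n r (F - {e})) F)"
    by (subst sum.reindex) (auto simp: inj_on_def)
  also have "\<dots> \<le> (\<Sum>e\<in>F. fact k * (\<Prod>i<k. 1 / a i) * (1 / a k))"
  proof (rule sum_mono)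
    fix e assume e: "e \<in> F"
    have sub: "F - {e} \<subseteq> Star n r x" "card (F - {e}) = k" using Suc.prems e fF by auto
    have av: "a k \<le> card (avail n r (F - {e}))" using Suc.prems(1)[of k "F - {e}"] sub by auto
    moreover have "0 < a k" using Suc.prems(2) by simp
    ultimately have ne: "avail n r (F - {e}) \<noteq> {}" by (metis card.empty not_less of_nat_0)
    have "pmf (step n r (F - {e})) F \<le> 1 / card (avail n r (F - {e}))"
      using ne by (rule pmf_step_le)
    also have "\<dots> \<le> 1 / a k" using av \<open>0 < a k\<close> by (intro divide_left_mono) auto
    finally have 1: "pmf (step n r (F - {e})) F \<le> 1 / a k" .
    have 2: "pmf (proc n r k) (F - {e}) \<le> fact k * (\<Prod>i<k. 1 / a i)"
      using sub by (intro Suc.IH Suc.prems(1,2)) auto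
    show "pmf (proc n r k) (F - {e}) * pmf (step n r (F - {e})) F \<le> fact k * (\<Prod>i<k. 1 / a i) * (1 / a k)"
      using 1 2 Suc.prems(2)
      by (intro mult_mono) (auto intro!: mult_nonneg_nonneg prod_nonneg intro: less_imp_le)
  qed
  also have "\<dots> = fact (Suc k) * (\<Prod>i<Suc k. 1 / a i)"
    using Suc.prems(4) by (simp add: algebra_simps)
  finally show ?case .
qed

text \<open>Up to time \<open>M\<close> every star reached has exactly \<open>k\<close> members, by
  \<open>card_proc_star\<close>; smaller and larger families carry no mass.\<close>

lemma sum_over_star_subsets:
  assumes "x \<in> {1..n}" "k \<le> M"
  shows "(\<Sum>F\<in>Pow (rsets n r). pmf (proc n r k) F * (if F \<subseteq> Star n r x then h F else 0)) =
     (\<Sum>F | F \<subseteq> Star n r x \<and> card F = k. pmf (proc n r k) F * h F)"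
proof -
  let ?S = "{F. F \<subseteq> Star n r x \<and> card F = k}"
  have "(\<Sum>F\<in>?S. pmf (proc n r k) F * h F) =
     (\<Sum>F\<in>?S. pmf (proc n r k) F * (if F \<subseteq> Star n r x then h F else 0))"
    by (intro sum.cong) auto
  also have "\<dots> = (\<Sum>F\<in>Pow (rsets n r). pmf (proc n r k) F * (if F \<subseteq> Star n r x then h F else 0))"
  proof (rule sum.mono_neutral_left)
    show "?S \<subseteq> Pow (rsets n r)" by (auto simp: Star_def)
    show "\<forall>F\<in>Pow (rsets n r) - ?S. pmf (proc n r k) F * (if F \<subseteq> Star n r x then h F else 0) = 0"
      using card_proc_star[OF _ assms(1) _ assms(2)] by (auto simp: set_pmf_iff)
  qed simp
  finally show ?thesis by simp
qed

text \<open>Sum \<open>pmf_proc_le\<close> over the \<open>M choose k\<close> subfamilies; the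
  orders of arrival turn this count into at most \<open>M ^ k\<close>.\<close>

lemma prob_subset_Star_le:
  fixes a :: "nat \<Rightarrow> real"
  assumes "x \<in> {1..n}" "k \<le> M"
    and "\<And>i G. i < k \<Longrightarrow> G \<subseteq> Star n r x \<Longrightarrow> card G = i \<Longrightarrow> a i \<le> card (avail n r G)"
    and "\<And>i. i < k \<Longrightarrow> 0 < a i"
  shows "P k {F. F \<subseteq> Star n r x} \<le> (\<Prod>i<k. M / a i)"
proof -
  have pos: "0 \<le> (\<Prod>i<k. 1 / a i)" using assms(4) by (intro prod_nonneg) (auto intro: less_imp_le)
  have "P k {F. F \<subseteq> Star n r x} = (\<Sum>F | F \<subseteq> Star n r x \<and> card F = k. pmf (proc n r k) F)"
    using sum_over_star_subsets[OF assms(1,2), of "\<lambda>_. 1"]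
    unfolding prob_proc_sum by (simp only: indicator_def of_bool_def mem_Collect_eq mult_1_right)
  also have "\<dots> \<le> (\<Sum>F | F \<subseteq> Star n r x \<and> card F = k. fact k * (\<Prod>i<k. 1 / a i))"
    using assms(3,4) by (intro sum_mono pmf_proc_le) auto
  also have "\<dots> = real ((M choose k) * fact k) * (\<Prod>i<k. 1 / a i)"
    using n_subsets[of "Star n r x" k] card_Star[OF assms(1) r1] by simp
  also have "\<dots> \<le> real (M ^ k) * (\<Prod>i<k. 1 / a i)"
    by (intro mult_right_mono of_nat_mono binomial_fact_pow pos)
  also have "\<dots> = (\<Prod>i<k. M / a i)"
    by (simp add: prod_dividef)
  finally show ?thesis .
qed

text \<open>First-moment bound: the factor \<open>n\<close> is the number of possible common
  points.\<close>

lemma prob_star_le: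
  fixes a :: "nat \<Rightarrow> real"
  assumes "k \<le> M"
    and "\<And>x i G. i < k \<Longrightarrow> G \<subseteq> Star n r x \<Longrightarrow> card G = i \<Longrightarrow> a i \<le> card (avail n r G)"
    and "\<And>i. i < k \<Longrightarrow> 0 < a i"
  shows "P k {F. is_star n F} \<le> n * (\<Prod>i<k. M / a i)"
proof -
  have "P k {F. is_star n F} \<le> P k (\<Union>x\<in>{1..n}. {F. F \<subseteq> Star n r x})"
  proof (rule measure_pmf.finite_measure_mono_AE)
    show "AE F in proc n r k. F \<in> {F. is_star n F} \<longrightarrow> F \<in> (\<Union>x\<in>{1..n}. {F. F \<subseteq> Star n r x})"
    proof -
      have "\<exists>x\<in>{1..n}. F \<subseteq> Star n r x" if "F \<in> set_pmf (proc n r k)" "is_star n F" for F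
        using that(2) set_proc[of k] that(1) unfolding is_star_def Star_def by blast
      then show ?thesis by (auto simp: AE_measure_pmf_iff)
    qed
  qed simp
  also have "\<dots> \<le> (\<Sum>x\<in>{1..n}. P k {F. F \<subseteq> Star n r x})"
    by (rule measure_UNION_le) auto
  also have "\<dots> \<le> (\<Sum>x\<in>{1..n}. \<Prod>i<k. M / a i)"
    using assms by (intro sum_mono prob_subset_Star_le) auto
  finally show ?thesis by simp
qed

section \<open>Survival of stars\<close>

text \<open>\<open>D\<close> is the number of choices for \<open>e\<^sub>2\<close>; \<open>\<kappa> / (M choose k)\<close> bounds the probability of reaching a given
  \<open>k\<close>-subfamily of a star, and \<open>\<rho>\<close> the fraction of a star met by an \<open>r\<close>-set outside it.\<close>
abbreviation "D \<equiv> real N - real ((n - r) choose r) - 1"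
abbreviation "\<kappa> \<equiv> real M * (real M - 1) / (real N * D)"
abbreviation "\<rho> \<equiv> real r * (real r - 1) / (real n - 1)"

lemma N_eq: "real N = real n * real M / real r"
proof -
  have "r * N = n * M" using times_binomial_minus1_eq[of r n] r1 by simp
  then have "real r * real N = real n * real M" by (metis of_nat_mult)
  then show ?thesis using r1 by (simp add: field_simps)
qed

lemma codegree_eq:
  assumes "2 \<le> r"
  shows "real ((n - 2) choose (r - 2)) = real M * (real r - 1) / (real n - 1)"
proof -
  have "(r - 1) * M = (n - 1) * ((n - 2) choose (r - 2))"
    using times_binomial_minus1_eq[of "r - 1" "n - 1"] assms by (simp add: numeral_2_eq_2)
  then have "real (r - 1) * real M = real (n - 1) * real ((n - 2) choose (r - 2))"
    by (metis of_nat_mult)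
  then show ?thesis using assms rn by (simp add: field_simps of_nat_diff)
qed

lemma \<rho>_nonneg: "0 \<le> \<rho>"
  using r1 rn by simp

text \<open>Union bound over the \<open>r\<close> points \<open>y\<close> of \<open>f\<close>: by
  \<open>codegree_eq\<close>, the pair \<open>x\<close>, \<open>y\<close> lies in
  \<open>M * (r - 1) / (n - 1)\<close> of the \<open>r\<close>-sets.\<close>

lemma card_Star_meeting_le:
  assumes "2 \<le> r" "x \<in> {1..n}" "f \<in> rsets n r" "x \<notin> f"
  shows "real (card {e \<in> Star n r x. e \<inter> f \<noteq> {}}) \<le> \<rho> * M"
proof -
  have f: "f \<subseteq> {1..n}" "card f = r" "finite f" using rsetsD[OF assms(3)] by auto
  have "card {e \<in> Star n r x. e \<inter> f \<noteq> {}} \<le> card (\<Union>y\<in>f. {e \<in> rsets n r. {x, y} \<subseteq> e})"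
    using f by (intro card_mono) (auto simp: Star_def)
  also have "\<dots> \<le> (\<Sum>y\<in>f. card {e \<in> rsets n r. {x, y} \<subseteq> e})"
    using f by (intro card_UN_le) auto
  also have "\<dots> = (\<Sum>y\<in>f. (n - 2) choose (r - 2))"
  proof (rule sum.cong)
    fix y assume "y \<in> f"
    then have "x \<noteq> y" using assms by auto
    then have "card {x, y} = 2" by simp
    then show "card {e \<in> rsets n r. {x, y} \<subseteq> e} = (n - 2) choose (r - 2)"
      using card_rsets_containing[of "{x, y}" n r] assms f \<open>y \<in> f\<close> by auto
  qed simp
  finally have "real (card {e \<in> Star n r x. e \<inter> f \<noteq> {}}) \<le> real (r * ((n - 2) choose (r - 2)))"
    using f by (simp only: of_nat_le_iff) simp
  then show ?thesis using codegree_eq[OF assms(1)] by (simp add: field_simps)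
qed

text \<open>Count pairs \<open>(F, f)\<close> from the side of \<open>f\<close>: if \<open>f\<close>
  meets \<open>K f\<close> members of the star, it is hit by all members of
  \<open>K f choose i\<close> subfamilies. \<open>binomial_ratio_power\<close> compares this with
  \<open>M choose i\<close>.\<close>

lemma sum_hitting_le:
  assumes "2 \<le> r" "x \<in> {1..n}"
  shows "real (\<Sum>F | F \<subseteq> Star n r x \<and> card F = i. card (hitting n r x F))
          \<le> real ((n - 1) choose r) * real (M choose i) * \<rho> ^ i"
proof -
  let ?S = "{F. F \<subseteq> Star n r x \<and> card F = i}" and ?R = "{f \<in> rsets n r. f \<inter> {x} = {}}"
  define K where "K f = card {e \<in> Star n r x. e \<inter> f \<noteq> {}}" for f
  have "(\<Sum>F\<in>?S. card (hitting n r x F)) = (\<Sum>F\<in>?S. \<Sum>f\<in>?R. if \<forall>e\<in>F. f \<inter> e \<noteq> {} then 1 else 0)"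
    by (intro sum.cong refl)
      (auto simp: hitting_def sum.If_cases Int_def intro!: arg_cong[where f = card])
  also have "\<dots> = (\<Sum>f\<in>?R. \<Sum>F\<in>?S. if \<forall>e\<in>F. f \<inter> e \<noteq> {} then 1 else 0)"
    by (rule sum.swap)
  also have "\<dots> = (\<Sum>f\<in>?R. K f choose i)"
  proof (rule sum.cong)
    fix f
    have "(\<Sum>F\<in>?S. if \<forall>e\<in>F. f \<inter> e \<noteq> {} then 1 else 0) = card {F \<in> ?S. \<forall>e\<in>F. f \<inter> e \<noteq> {}}"
      by (simp add: sum.If_cases Int_def)
    also have "{F \<in> ?S. \<forall>e\<in>F. f \<inter> e \<noteq> {}} = {F. F \<subseteq> {e \<in> Star n r x. e \<inter> f \<noteq> {}} \<and> card F = i}"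
      by (auto simp: Int_commute)
    also have "card \<dots> = K f choose i"
      unfolding K_def by (rule n_subsets) simp
    finally show "(\<Sum>F\<in>?S. if \<forall>e\<in>F. f \<inter> e \<noteq> {} then 1 else 0) = K f choose i" .
  qed simp
  finally have eq: "(\<Sum>F\<in>?S. card (hitting n r x F)) = (\<Sum>f\<in>?R. K f choose i)" .
  have "real (K f choose i) \<le> real (M choose i) * \<rho> ^ i" if f: "f \<in> ?R" for f
  proof -
    have KM: "K f \<le> M"
      unfolding K_def card_Star[OF assms(2) r1, symmetric] by (intro card_mono) auto
    have "real ((K f choose i) * M ^ i) \<le> real ((M choose i) * K f ^ i)"
      using binomial_ratio_power[OF KM, of i] by (simp only: of_nat_le_iff)
    also have "\<dots> \<le> real (M choose i) * (\<rho> * M) ^ i"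
      using card_Star_meeting_le[OF assms, of f] f
      by (auto simp: K_def intro!: mult_left_mono power_mono)
    finally have "real (K f choose i) * real M ^ i \<le> (real (M choose i) * \<rho> ^ i) * real M ^ i"
      by (simp only: power_mult_distrib of_nat_mult of_nat_power mult.assoc)
    then show ?thesis using M_pos by (simp only: mult_le_cancel_right_pos zero_less_power of_nat_0_less_iff)
  qed
  then have "real (\<Sum>f\<in>?R. K f choose i) \<le> (\<Sum>f\<in>?R. real (M choose i) * \<rho> ^ i)"
    unfolding of_nat_sum by (rule sum_mono)
  also have "\<dots> = real ((n - 1) choose r) * real (M choose i) * \<rho> ^ i"
    using card_rsets_avoiding[of "{x}" n r] assms by simp
  finally show ?thesis unfolding eq .
qed

lemma card_avail_empty: "card (avail n r {}) = N"
  by (simp add: avail_def card_rsets)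

lemma card_avail_single:
  assumes "a \<in> rsets n r"
  shows "real (card (avail n r {a})) = D"
proof -
  have a: "a \<subseteq> {1..n}" "card a = r" "finite a" using rsetsD[OF assms] by auto
  have ne: "a \<noteq> {}" using a r1 by auto
  let ?X = "{e \<in> rsets n r. e \<inter> a = {}}"
  have cX: "card ?X = (n - r) choose r" using card_rsets_avoiding[OF a(1)] a by simp
  have "avail n r {a} = rsets n r - insert a ?X" by (auto simp: avail_def)
  moreover have "insert a ?X \<subseteq> rsets n r" using assms by auto
  moreover have "card (insert a ?X) = Suc ((n - r) choose r)"
    using ne cX by (subst card_insert_disjoint) auto
  ultimately have "card (avail n r {a}) + Suc ((n - r) choose r) = N"
    using card_Diff_subset[of "insert a ?X" "rsets n r"] card_mono[of "rsets n r" "insert a ?X"]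
    by (simp add: card_rsets)
  then show ?thesis by linarith
qed

lemma pmf_proc_Star_le:
  assumes "x \<in> {1..n}" "0 < D" "2 \<le> k" "k \<le> M" "F \<subseteq> Star n r x" "card F = k"
  shows "pmf (proc n r k) F \<le> \<kappa> / real (M choose k)"
proof -
  define a :: "nat \<Rightarrow> real" where "a i = (if i = 0 then N else if i = 1 then D else real M - real i)" for i
  have apos: "0 < a i" if "i < k" for i
    using that assms(2,4) rn by (auto simp: a_def)
  have "pmf (proc n r k) F \<le> fact k * (\<Prod>i<k. 1 / a i)"
  proof (rule pmf_proc_le)
    fix i G assume i: "i < k" and G: "G \<subseteq> Star n r x" "card G = i"
    have fG: "finite G" using G(1) by (rule finite_subset) simp
    consider "i = 0" | "i = 1" | "2 \<le> i" by linarith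
    then show "a i \<le> card (avail n r G)"
    proof cases
      case 1
      then have "G = {}" using G fG by simp
      then show ?thesis using 1 by (simp add: a_def card_avail_empty)
    next
      case 2
      then obtain b where b: "G = {b}" using G by (auto simp: card_1_singleton_iff)
      then have "b \<in> rsets n r" using G by (auto simp: Star_def)
      then show ?thesis using 2 card_avail_single b by (simp add: a_def)
    next
      case 3
      have "real (M - i) \<le> real (card (avail n r G))"
        using card_avail_star[OF assms(1) G(1)] G(2) by simp
      then show ?thesis using 3 i assms(4) by (simp add: a_def of_nat_diff)
    qed
  qed (use apos assms in auto)
  also have "fact k * (\<Prod>i<k. 1 / a i) = \<kappa> / real (M choose k)"
    using assms(3,4)
  proof (induction k rule: dec_induct)
    case base
    have z: "real M * (real M - 1) \<noteq> 0" unfolding mult_eq_0_iff using base by linarith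
    have frac: "z / w / (z / 2) = 2 / w" if "z \<noteq> 0" for z w :: real using that by simp
    have c: "real (M choose 2) = real M * (real M - 1) / 2"
    proof -
      have "2 * (M choose 2) = M * (M - 1)" using binomial_absorption[of 1 M] by (simp add: numeral_2_eq_2)
      then have eq: "2 * real (M choose 2) = real M * real (M - 1)" by (metis of_nat_mult of_nat_numeral)
      have "real (M - 1) = real M - 1" using M_pos by linarith
      with eq show ?thesis by (metis nonzero_mult_div_cancel_left zero_neq_numeral)
    qed
    have "fact 2 * (\<Prod>i<2. 1 / a i) = 2 / (real N * D)" by (simp add: numeral_2_eq_2 a_def)
    then show ?case unfolding c frac[OF z] .
  next
    case (step k)
    have "Suc k * (M choose Suc k) = (M - k) * (M choose k)"
      by (simp only: binomial_absorb_comp binomial_absorption)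
    then have eq: "real (Suc k) * real (M choose Suc k) = (real M - real k) * real (M choose k)"
      using step.prems by (metis Suc_leD of_nat_diff of_nat_mult)
    have ak: "a k = real M - real k" and pos: "0 < real M - real k" using step by (auto simp: a_def)
    have c: "0 < real (M choose k)" "0 < real (M choose Suc k)" using step by auto
    have "fact (Suc k) * (\<Prod>i<Suc k. 1 / a i) = real (Suc k) / (real M - real k) * (fact k * (\<Prod>i<k. 1 / a i))"
      by (simp add: ak field_simps)
    also have "\<dots> = real (Suc k) / (real M - real k) * (\<kappa> / real (M choose k))"
      using step by simp
    also have "\<dots> = \<kappa> * (real (Suc k) / ((real M - real k) * real (M choose k)))"
    proof -
      have "s / m * (z / c) = z * (s / (m * c))" for s m z c :: real by simp
      then show ?thesis .
    qed
    also have "\<dots> = \<kappa> / real (M choose Suc k)"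
      unfolding eq[symmetric] by simp
    finally show ?case .
  qed
  finally show ?thesis .
qed

lemma expected_hitting_le:
  assumes "2 \<le> r" "x \<in> {1..n}" "0 < D" "2 \<le> k" "k \<le> M"
  shows "(\<Sum>F | F \<subseteq> Star n r x \<and> card F = k. pmf (proc n r k) F * real (card (hitting n r x F)))
    \<le> \<kappa> * real ((n - 1) choose r) * \<rho> ^ k"
proof -
  let ?S = "{F. F \<subseteq> Star n r x \<and> card F = k}"
  have c: "0 < real (M choose k)" using assms by simp
  have kn: "0 \<le> \<kappa>" using assms M_pos by (intro divide_nonneg_nonneg mult_nonneg_nonneg) auto
  have "(\<Sum>F\<in>?S. pmf (proc n r k) F * real (card (hitting n r x F)))
      \<le> (\<Sum>F\<in>?S. \<kappa> / real (M choose k) * real (card (hitting n r x F)))"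
    using assms by (intro sum_mono mult_right_mono pmf_proc_Star_le) auto
  also have "\<dots> = \<kappa> / real (M choose k) * real (\<Sum>F\<in>?S. card (hitting n r x F))"
    by (simp add: sum_distrib_left)
  also have "\<dots> \<le> \<kappa> / real (M choose k) * (real ((n - 1) choose r) * real (M choose k) * \<rho> ^ k)"
    using divide_nonneg_nonneg[OF kn, of "real (M choose k)"]
    by (intro mult_left_mono sum_hitting_le[OF assms(1,2)]) simp_all
  also have "\<dots> = \<kappa> * real ((n - 1) choose r) * \<rho> ^ k"
    using c by simp
  finally show ?thesis .
qed

lemma prob_step_leave_Star_le:
  assumes "x \<in> {1..n}" "F \<subseteq> Star n r x" "card F < M"
  shows "measure_pmf.prob (step n r F) {G. \<not> is_star n G} \<le> card (hitting n r x F) / (real M - real (card F))"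
proof -
  have av: "real M - real (card F) \<le> card (avail n r F)"
    using card_avail_star[OF assms(1,2)] assms(3) by linarith
  then have ne: "avail n r F \<noteq> {}" using assms(3) by auto
  have "{e \<in> avail n r F. insert e F \<in> {G. \<not> is_star n G}} \<subseteq> hitting n r x F"
    using assms(1,2) by (auto simp: avail_def hitting_def is_star_def Star_def)
  then have "card {e \<in> avail n r F. insert e F \<in> {G. \<not> is_star n G}} \<le> card (hitting n r x F)"
    by (intro card_mono) auto
  then show ?thesis unfolding prob_step[OF ne]
    using av assms(3) by (intro frac_le) auto
qed

text \<open>A star is lost only by picking a set from \<open>hitting\<close>, out of at least
  \<open>M - k\<close> options. Each possible centre is charged separately, whence the factor
  \<open>n\<close>, and \<open>expected_hitting_le\<close> averages over the state.\<close>

lemma star_loss: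
  assumes "2 \<le> r" "0 < D" "2 \<le> k" "k < M"
  shows "P k {F. is_star n F} - P (Suc k) {F. is_star n F}
          \<le> n * (\<kappa> * real ((n - 1) choose r) * \<rho> ^ k) / (real M - real k)"
proof -
  let ?U = "Pow (rsets n r)" and ?m = "real M - real k"
  let ?h = "\<lambda>x F. if F \<subseteq> Star n r x then real (card (hitting n r x F)) / ?m else 0"
  have "P k {F. is_star n F} - P (Suc k) {F. is_star n F} =
    (\<Sum>F\<in>?U. pmf (proc n r k) F * (indicator {F. is_star n F} F - measure_pmf.prob (step n r F) {F. is_star n F}))"
    unfolding prob_proc_Suc prob_proc_sum[of k] by (simp add: sum_subtractf algebra_simps)
  also have "\<dots> \<le> (\<Sum>F\<in>?U. pmf (proc n r k) F * (\<Sum>x\<in>{1..n}. ?h x F))"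
  proof (rule sum_mono)
    fix F assume "F \<in> ?U"
    have nn: "0 \<le> ?h x F" for x using assms by auto
    have "indicator {F. is_star n F} F - measure_pmf.prob (step n r F) {F. is_star n F} \<le> (\<Sum>x\<in>{1..n}. ?h x F)"
      if F: "F \<in> set_pmf (proc n r k)"
    proof (cases "is_star n F")
      case True
      then obtain x where x: "x \<in> {1..n}" "F \<subseteq> Star n r x"
        using \<open>F \<in> ?U\<close> unfolding is_star_def Star_def by blast
      have cF: "card F = k" using card_proc_star[OF F x] assms by simp
      have "1 - measure_pmf.prob (step n r F) {F. is_star n F} = measure_pmf.prob (step n r F) {F. \<not> is_star n F}"
        using measure_pmf.prob_compl[of "{F. is_star n F}" "step n r F"]
        by (simp add: Collect_neg_eq Compl_eq_Diff_UNIV)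
      also have "\<dots> \<le> ?h x F"
        using prob_step_leave_Star_le[OF x] cF x assms by simp
      also have "\<dots> \<le> (\<Sum>x\<in>{1..n}. ?h x F)"
        using x nn by (intro member_le_sum) auto
      finally show ?thesis using True by simp
    next
      case False
      have "0 \<le> (\<Sum>x\<in>{1..n}. ?h x F)" using nn by (intro sum_nonneg)
      then show ?thesis using False by (simp add: add_nonneg_nonneg minus_le_iff) (smt (verit) measure_nonneg)
    qed
    then show "pmf (proc n r k) F * (indicator {F. is_star n F} F - measure_pmf.prob (step n r F) {F. is_star n F})
         \<le> pmf (proc n r k) F * (\<Sum>x\<in>{1..n}. ?h x F)"
      by (cases "F \<in> set_pmf (proc n r k)") (auto simp: set_pmf_iff intro: mult_left_mono)
  qed
  also have "\<dots> = (\<Sum>x\<in>{1..n}. \<Sum>F\<in>?U. pmf (proc n r k) F * ?h x F)"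
    unfolding sum_distrib_left by (rule sum.swap)
  also have "\<dots> = (\<Sum>x\<in>{1..n}. (\<Sum>F | F \<subseteq> Star n r x \<and> card F = k. pmf (proc n r k) F * real (card (hitting n r x F))) / ?m)"
    using assms by (intro sum.cong refl) (subst sum_over_star_subsets, auto simp: sum_divide_distrib)
  also have "\<dots> \<le> (\<Sum>x\<in>{1..n}. (\<kappa> * real ((n - 1) choose r) * \<rho> ^ k) / ?m)"
    using assms by (intro sum_mono divide_right_mono expected_hitting_le) auto
  finally show ?thesis by simp
qed

text \<open>Once \<open>hitting\<close> is empty, every available set contains \<open>x\<close>, so
  the process is forced to complete the star.\<close>

definition locked :: "nat set set set" where
  "locked = {F. \<exists>x\<in>{1..n}. F \<subseteq> Star n r x \<and> hitting n r x F = {}}"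

lemma locked_increasing:
  assumes "j \<le> k" shows "P j locked \<le> P k locked"
  using assms
proof (induction rule: dec_induct)
  case (step k)
  have "P k locked \<le> P (Suc k) locked"
  proof (rule prob_proc_Suc_ge)
    fix F e assume F: "F \<in> locked" and e: "e \<in> avail n r F"
    then obtain x where x: "x \<in> {1..n}" "F \<subseteq> Star n r x" "hitting n r x F = {}" by (auto simp: locked_def)
    have "x \<in> e" "e \<in> rsets n r" using e x(3) by (auto simp: hitting_def avail_def)
    then have "insert e F \<subseteq> Star n r x" using x by (auto simp: Star_def)
    moreover have "hitting n r x (insert e F) = {}" using x(3) by (auto simp: hitting_def)
    ultimately show "insert e F \<in> locked" using x(1) by (auto simp: locked_def)
  qed
  then show ?case using step by simp
qed simp

text \<open>A locked family stays locked, and a halted family inside a star is the full star, of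
  size \<open>M\<close>.\<close>

lemma probE_ge_locked:
  assumes "k \<le> N" shows "P k locked \<le> probE n r"
proof -
  have "P k locked \<le> P N locked" using assms by (rule locked_increasing)
  also have "\<dots> \<le> probE n r"
    unfolding probE_def process_eq card_rsets
  proof (rule measure_pmf.finite_measure_mono_AE)
    have "card F = M" if F: "F \<in> set_pmf (proc n r N)" and L: "F \<in> locked" for F
    proof -
      obtain x where x: "x \<in> {1..n}" "F \<subseteq> Star n r x" using L unfolding locked_def by blast
      have "avail n r F = {}" using process_halted F by (simp add: process_eq card_rsets)
      then have "F = Star n r x" using Star_diff_subset_avail[OF x(2)] x(2) by auto
      then show ?thesis using card_Star[OF x(1) r1] by simp
    qed
    then show "AE F in proc n r N. F \<in> locked \<longrightarrow> F \<in> {F. card F = M}"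
      by (auto simp: AE_measure_pmf_iff)
  qed simp
  finally show ?thesis .
qed

text \<open>Markov's inequality: a star that is not locked has at least one hitting set for each of
  its centres.\<close>

lemma locked_ge:
  assumes "2 \<le> r" "0 < D" "2 \<le> k" "k \<le> M"
  shows "P k {F. is_star n F} - n * (\<kappa> * real ((n - 1) choose r) * \<rho> ^ k) \<le> P k locked"
proof -
  let ?U = "Pow (rsets n r)"
  let ?h = "\<lambda>x F. if F \<subseteq> Star n r x then real (card (hitting n r x F)) else 0"
  have "P k {F. is_star n F} - P k locked =
     (\<Sum>F\<in>?U. pmf (proc n r k) F * (indicator {F. is_star n F} F - indicator locked F))"
    unfolding prob_proc_sum by (simp add: sum_subtractf right_diff_distrib)
  also have "\<dots> \<le> (\<Sum>F\<in>?U. pmf (proc n r k) F * (\<Sum>x\<in>{1..n}. ?h x F))"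
  proof (intro sum_mono mult_left_mono)
    fix F assume U: "F \<in> ?U"
    show "(indicator {F. is_star n F} F :: real) - indicator locked F \<le> (\<Sum>x\<in>{1..n}. ?h x F)"
    proof (cases "is_star n F \<and> F \<notin> locked")
      case True
      then obtain x where x: "x \<in> {1..n}" "F \<subseteq> Star n r x"
        using U unfolding is_star_def Star_def by blast
      then have "hitting n r x F \<noteq> {}" using True by (auto simp: locked_def)
      then have "0 < card (hitting n r x F)" by (simp add: card_gt_0_iff)
      then have "1 \<le> ?h x F" using x(2) by simp
      also have "\<dots> \<le> (\<Sum>x\<in>{1..n}. ?h x F)"
        using x by (intro member_le_sum) auto
      finally show ?thesis using True by simp
    next
      case False
      moreover have "0 \<le> (\<Sum>x\<in>{1..n}. ?h x F)" by (intro sum_nonneg) auto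
      ultimately show ?thesis by (auto simp: indicator_def)
    qed
  qed simp
  also have "\<dots> = (\<Sum>x\<in>{1..n}. \<Sum>F\<in>?U. pmf (proc n r k) F * ?h x F)"
    unfolding sum_distrib_left by (rule sum.swap)
  also have "\<dots> = (\<Sum>x\<in>{1..n}. \<Sum>F | F \<subseteq> Star n r x \<and> card F = k. pmf (proc n r k) F * real (card (hitting n r x F)))"
    using assms by (intro sum.cong[OF refl] sum_over_star_subsets) auto
  also have "\<dots> \<le> (\<Sum>x\<in>{1..n}. \<kappa> * real ((n - 1) choose r) * \<rho> ^ k)"
    using assms by (intro sum_mono expected_hitting_le) auto
  finally show ?thesis by simp
qed

text \<open>Stopping the step-by-step bound at \<open>m = M div 2 + 1\<close> keeps \<open>M - k \<ge> M / 2\<close> in every term, while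
  a star with \<open>m\<close> members is already locked with overwhelming probability.\<close>
lemma probE_ge_star:
  assumes "2 \<le> r" "0 < D" "4 \<le> M"
  shows "P 3 {F. is_star n F} - n * \<kappa> * real ((n - 1) choose r) *
      ((\<Sum>k\<in>{3..<M div 2 + 1}. \<rho> ^ k / (real M - real k)) + \<rho> ^ (M div 2 + 1)) \<le> probE n r"
proof -
  let ?c = "n * \<kappa> * real ((n - 1) choose r)" and ?m = "M div 2 + 1"
  have 1: "P 3 {F. is_star n F} - ?c * (\<Sum>k\<in>{3..<m}. \<rho> ^ k / (real M - real k)) \<le> P m {F. is_star n F}"
    if "3 \<le> m" "m \<le> M" for m
    using that
  proof (induction m rule: dec_induct)
    case (step m)
    have "?c * (\<Sum>k\<in>{3..<Suc m}. \<rho> ^ k / (real M - real k)) =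
       ?c * (\<Sum>k\<in>{3..<m}. \<rho> ^ k / (real M - real k)) + n * (\<kappa> * real ((n - 1) choose r) * \<rho> ^ m) / (real M - real m)"
      using step.hyps by (simp add: distrib_left)
    then show ?case using step star_loss[OF assms(1,2), of m] by linarith
  qed simp
  have m: "3 \<le> ?m" "?m \<le> M" using assms(3) by auto
  have "P ?m locked \<le> probE n r" using m M_le_N by (intro probE_ge_locked) simp
  moreover have "P ?m {F. is_star n F} - n * (\<kappa> * real ((n - 1) choose r) * \<rho> ^ ?m) \<le> P ?m locked"
    using assms m by (intro locked_ge) auto
  moreover have "?c * ((\<Sum>k\<in>{3..<?m}. \<rho> ^ k / (real M - real k)) + \<rho> ^ ?m) =
     ?c * (\<Sum>k\<in>{3..<?m}. \<rho> ^ k / (real M - real k)) + n * (\<kappa> * real ((n - 1) choose r) * \<rho> ^ ?m)"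
    by (simp add: distrib_left)
  ultimately show ?thesis using 1[OF m] by linarith
qed

section \<open>The first three sets\<close>

lemma card_avoiding_either:
  assumes "a \<in> rsets n r" "b \<in> rsets n r"
  shows "real (card ({e \<in> rsets n r. e \<inter> a = {}} \<union> {e \<in> rsets n r. e \<inter> b = {}})) =
     2 * real ((n - r) choose r) - real ((n - card (a \<union> b)) choose r)"
proof -
  let ?A = "{e \<in> rsets n r. e \<inter> a = {}}" and ?B = "{e \<in> rsets n r. e \<inter> b = {}}"
  have ab: "a \<subseteq> {1..n}" "card a = r" "b \<subseteq> {1..n}" "card b = r"
    using rsetsD[OF assms(1)] rsetsD[OF assms(2)] by auto
  have "?A \<inter> ?B = {e \<in> rsets n r. e \<inter> (a \<union> b) = {}}" by auto
  then have "card (?A \<inter> ?B) = (n - card (a \<union> b)) choose r"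
    using card_rsets_avoiding[of "a \<union> b" n r] ab by simp
  moreover have "card ?A = (n - r) choose r" "card ?B = (n - r) choose r"
    using card_rsets_avoiding ab by auto
  moreover have "card ?A + card ?B = card (?A \<union> ?B) + card (?A \<inter> ?B)"
    by (intro card_Un_Int) auto
  ultimately show ?thesis by linarith
qed

text \<open>Inclusion-exclusion, with \<open>card (a \<union> b)\<close> replaced by its maximum
  \<open>2 * r\<close>; the final 2 accounts for \<open>a\<close> and \<open>b\<close>
  themselves.\<close>

lemma card_avail_pair:
  assumes "a \<in> rsets n r" "b \<in> rsets n r"
  shows "real N - 2 * real ((n - r) choose r) + real ((n - 2 * r) choose r) - 2 \<le> card (avail n r {a, b})"
proof -
  let ?C = "{e \<in> rsets n r. e \<inter> a = {}} \<union> {e \<in> rsets n r. e \<inter> b = {}}"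
  have "card (a \<union> b) \<le> 2 * r"
    using card_Un_le[of a b] rsetsD[OF assms(1)] rsetsD[OF assms(2)] by linarith
  then have "(n - 2 * r) choose r \<le> (n - card (a \<union> b)) choose r"
    by (intro binomial_right_mono) auto
  moreover have "avail n r {a, b} = rsets n r - (?C \<union> {a, b})" by (auto simp: avail_def)
  then have "card (rsets n r) - card (?C \<union> {a, b}) \<le> card (avail n r {a, b})"
    by (simp only:) (intro diff_card_le_card_Diff, auto)
  moreover have "card (?C \<union> {a, b}) \<le> card ?C + 2"
    using card_Un_le[of ?C "{a, b}"] card_insert_le_m1[of 2 "{b}" a] by simp
  ultimately show ?thesis
    using card_avoiding_either[OF assms] by (simp add: card_rsets)
qed

text \<open>Union bound: each member excludes the sets disjoint from it, and itself.\<close>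

lemma card_avail_ge:
  assumes "G \<subseteq> rsets n r"
  shows "real N - real (card G) * (real ((n - r) choose r) + 1) \<le> card (avail n r G)"
proof -
  have fG: "finite G" using assms by (rule finite_subset) simp
  let ?C = "(\<Union>g\<in>G. insert g {e \<in> rsets n r. e \<inter> g = {}})"
  have "card (insert g {e \<in> rsets n r. e \<inter> g = {}}) \<le> ((n - r) choose r) + 1" if "g \<in> G" for g
    using card_rsets_avoiding[of g n r] rsetsD[of g n r] assms that
      card_insert_le_m1[of "((n - r) choose r) + 1" "{e \<in> rsets n r. e \<inter> g = {}}" g] by auto
  then have "card ?C \<le> card G * (((n - r) choose r) + 1)"
    using fG card_UN_le[OF fG, of "\<lambda>g. insert g {e \<in> rsets n r. e \<inter> g = {}}"]
      sum_bounded_above[of G "\<lambda>g. card (insert g {e \<in> rsets n r. e \<inter> g = {}})" "((n - r) choose r) + 1"]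
    by fastforce
  then have "real (card ?C) \<le> real (card G * (((n - r) choose r) + 1))" by (simp only: of_nat_le_iff)
  moreover have "avail n r G = rsets n r - ?C" by (auto simp: avail_def)
  then have "card (rsets n r) - card ?C \<le> card (avail n r G)"
    by (simp only:) (rule diff_card_le_card_Diff, use fG in simp)
  then have "real N - real (card ?C) \<le> card (avail n r G)" by (simp only: card_rsets)
  ultimately show ?thesis by (simp add: distrib_left)
qed

text \<open>If \<open>e\<^sub>1 \<inter> e\<^sub>2 = {x}\<close>, then \<open>T\<close> counts the choices for \<open>e\<^sub>3\<close> that avoid \<open>x\<close>, so \<open>\<tau>\<close> is the
  probability that \<open>x \<in> e\<^sub>3\<close>; \<open>\<delta>\<close> bounds the probability that \<open>e\<^sub>1\<close> and \<open>e\<^sub>2\<close> share more than one point.\<close>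
abbreviation "T \<equiv> real ((n - 1) choose r) - 2 * real ((n - r) choose r) + real ((n + 1 - 2 * r) choose r)"
abbreviation "\<tau> \<equiv> (real M - 2) / (real M - 2 + T)"
abbreviation "\<delta> \<equiv> \<rho> * (real r - 1) * real M / D"

text \<open>A set containing \<open>x\<close> meets both \<open>a\<close> and \<open>b\<close>, so
  the sets removed by inclusion-exclusion all avoid \<open>x\<close> already. The last term comes
  from \<open>card (a \<union> b) = 2 * r - 1\<close>.\<close>

lemma card_hitting_pair:
  assumes "a \<in> rsets n r" "b \<in> rsets n r" "a \<inter> b = {x}"
  shows "real (card (hitting n r x {a, b})) = T"
proof -
  let ?C = "{e \<in> rsets n r. e \<inter> a = {}} \<union> {e \<in> rsets n r. e \<inter> b = {}}"
  let ?R = "{e \<in> rsets n r. e \<inter> {x} = {}}"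
  have ab: "a \<subseteq> {1..n}" "card a = r" "finite a" "card b = r" "finite b"
    using rsetsD[OF assms(1)] rsetsD[OF assms(2)] by auto
  have "card (a \<union> b) = 2 * r - 1" using card_Un_Int[of a b] ab assms by simp
  then have nU: "n - card (a \<union> b) = n + 1 - 2 * r" using r1 rn by simp
  have x: "x \<in> a" "x \<in> b" using assms(3) by auto
  then have "x \<in> {1..n}" using ab by auto
  then have cR: "card ?R = (n - 1) choose r" using card_rsets_avoiding[of "{x}" n r] by simp
  have "hitting n r x {a, b} = ?R - ?C" by (auto simp: hitting_def)
  moreover have "?C \<subseteq> ?R" using x by auto
  ultimately have "card (hitting n r x {a, b}) = card ?R - card ?C" and "card ?C \<le> card ?R"
    using card_Diff_subset[of ?C ?R] card_mono[of ?R ?C] by auto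
  then show ?thesis using card_avoiding_either[OF assms(1,2)] cR nU by simp
qed

text \<open>As \<open>x\<close> is the only common point of \<open>a\<close> and \<open>b\<close>,
  the star survives exactly when the new set contains \<open>x\<close>; of the \<open>M\<close> such
  sets, the distinct \<open>a\<close> and \<open>b\<close> are already used.\<close>

lemma prob_step_pair:
  assumes "2 \<le> r" "2 < M" "a \<in> rsets n r" "b \<in> rsets n r" "a \<inter> b = {x}"
  shows "measure_pmf.prob (step n r {a, b}) {F. is_star n F} = \<tau>"
proof -
  have ab: "a \<subseteq> {1..n}" "card a = r"
    using rsetsD[OF assms(3)] by auto
  have x: "x \<in> a" "x \<in> b" using assms(5) by auto
  have xn: "x \<in> {1..n}" using x ab by auto
  have neq: "a \<noteq> b" using assms(1,5) ab by auto
  have sub: "{a, b} \<subseteq> Star n r x" using assms x by (auto simp: Star_def)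
  have "card (Star n r x - {a, b}) = M - 2"
    using card_Diff_subset[OF _ sub] card_Star[OF xn r1] neq by (simp add: numeral_2_eq_2)
  then have c1: "real (card (Star n r x - {a, b})) = real M - 2" using assms(2) by linarith
  have av: "avail n r {a, b} = (Star n r x - {a, b}) \<union> hitting n r x {a, b}"
    using x by (auto simp: avail_def Star_def hitting_def)
  have c2: "real (card (avail n r {a, b})) = real M - 2 + T"
    unfolding av using c1 card_hitting_pair[OF assms(3-5)]
    by (subst card_Un_disjoint) (auto simp: Star_def hitting_def)
  have "real (card (Star n r x - {a, b})) > 0" using c1 assms(2) by linarith
  then have ne: "avail n r {a, b} \<noteq> {}" unfolding av by fastforce
  have "{e \<in> avail n r {a, b}. insert e {a, b} \<in> {F. is_star n F}} = Star n r x - {a, b}" (is "?L = ?S")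
  proof
    show "?L \<subseteq> ?S"
    proof
      fix e assume e: "e \<in> ?L"
      then obtain y where "y \<in> e" "y \<in> a" "y \<in> b" by (auto simp: is_star_def)
      moreover from this have "y \<in> a \<inter> b" by simp
      ultimately have "x \<in> e" unfolding assms(5) by simp
      then show "e \<in> ?S" using e by (auto simp: avail_def Star_def)
    qed
    show "?S \<subseteq> ?L"
    proof
      fix e assume e: "e \<in> ?S"
      have "is_star n (insert e {a, b})"
        unfolding is_star_def using x xn e by (intro bexI[of _ x]) (auto simp: Star_def)
      then show "e \<in> ?L" using e av by simp
    qed
  qed
  then show ?thesis unfolding prob_step[OF ne] using c1 c2 by simp
qed

definition pairs_meeting_once :: "nat set set set" where
  "pairs_meeting_once = {F. \<exists>a\<in>rsets n r. \<exists>b\<in>rsets n r. \<exists>x. F = {a, b} \<and> a \<inter> b = {x}}"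

text \<open>Union bound over the \<open>r * (r - 1)\<close> ordered pairs of distinct points of the
  first set that the second set may contain.\<close>

lemma prob_not_meeting_once:
  assumes "2 \<le> r" "0 < D"
  shows "P 2 (- pairs_meeting_once) \<le> \<delta>"
proof -
  have step: "measure_pmf.prob (step n r F) (- pairs_meeting_once) \<le> \<delta>" if F: "F \<in> set_pmf (proc n r 1)" for F
  proof -
    have ne0: "avail n r {} \<noteq> {}" using card_avail_empty rn by auto
    have fF: "finite F" using proc_mem_finite[OF F] .
    have "F \<noteq> {}" using ne0 proc_invariant[OF F] by auto
    then have "card F = 1" using proc_invariant[OF F] fF by (metis One_nat_def card_0_eq le_SucE le_zero_eq)
    then obtain a where a: "F = {a}" "a \<in> rsets n r"
      using proc_invariant[OF F] by (auto simp: card_1_singleton_iff)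
    have ac: "a \<subseteq> {1..n}" "card a = r" "finite a" using rsetsD[OF a(2)] by auto
    have cav: "real (card (avail n r {a})) = D" using card_avail_single[OF a(2)] .
    then have ne: "avail n r {a} \<noteq> {}" using assms(2) by auto
    let ?L = "{e \<in> avail n r {a}. insert e {a} \<in> - pairs_meeting_once}"
    have "?L \<subseteq> (\<Union>y\<in>a. \<Union>z\<in>a - {y}. {e \<in> rsets n r. {y, z} \<subseteq> e})"
    proof
      fix e assume "e \<in> ?L"
      then have e: "e \<in> rsets n r" "e \<inter> a \<noteq> {}" "{e, a} \<notin> pairs_meeting_once" by (auto simp: avail_def)
      then obtain y where y: "y \<in> e \<inter> a" by blast
      have "e \<inter> a \<noteq> {y}" using e a(2) by (auto simp: pairs_meeting_once_def)
      then obtain z where "z \<in> e \<inter> a" "z \<noteq> y" using y by blast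
      then show "e \<in> (\<Union>y\<in>a. \<Union>z\<in>a - {y}. {e \<in> rsets n r. {y, z} \<subseteq> e})" using y e by blast
    qed
    then have "card ?L \<le> card (\<Union>y\<in>a. \<Union>z\<in>a - {y}. {e \<in> rsets n r. {y, z} \<subseteq> e})"
      using ac by (intro card_mono) auto
    also have "\<dots> \<le> (\<Sum>y\<in>a. card (\<Union>z\<in>a - {y}. {e \<in> rsets n r. {y, z} \<subseteq> e}))"
      using ac by (intro card_UN_le) auto
    also have "\<dots> \<le> (\<Sum>y\<in>a. \<Sum>z\<in>a - {y}. card {e \<in> rsets n r. {y, z} \<subseteq> e})"
      using ac by (intro sum_mono card_UN_le) auto
    also have "\<dots> = (\<Sum>y\<in>a. \<Sum>z\<in>a - {y}. (n - 2) choose (r - 2))"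
    proof (intro sum.cong refl)
      fix y z assume "y \<in> a" "z \<in> a - {y}"
      then have "y \<noteq> z" "{y, z} \<subseteq> {1..n}" using ac by auto
      then show "card {e \<in> rsets n r. {y, z} \<subseteq> e} = (n - 2) choose (r - 2)"
        using card_rsets_containing[of "{y, z}" n r] assms(1) by (simp add: numeral_2_eq_2)
    qed
    also have "\<dots> = r * (r - 1) * ((n - 2) choose (r - 2))"
      using ac by simp
    finally have "real (card ?L) \<le> real (r * (r - 1) * ((n - 2) choose (r - 2)))"
      by (simp only: of_nat_le_iff)
    also have "\<dots> = \<rho> * (real r - 1) * real M"
      using codegree_eq[OF assms(1)] r1 by (simp add: of_nat_diff)
    finally have "real (card ?L) / D \<le> \<rho> * (real r - 1) * real M / D"
      using assms(2) by (intro divide_right_mono) auto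
    then show ?thesis unfolding a(1) prob_step[OF ne] cav .
  qed
  have "P 2 (- pairs_meeting_once) = (\<Sum>F\<in>Pow (rsets n r). pmf (proc n r 1) F * measure_pmf.prob (step n r F) (- pairs_meeting_once))"
    using prob_proc_Suc[of 1] by (simp add: numeral_2_eq_2)
  also have "\<dots> \<le> (\<Sum>F\<in>Pow (rsets n r). pmf (proc n r 1) F * \<delta>)"
  proof (rule sum_mono)
    fix F
    show "pmf (proc n r 1) F * measure_pmf.prob (step n r F) (- pairs_meeting_once) \<le> pmf (proc n r 1) F * \<delta>"
    proof (cases "F \<in> set_pmf (proc n r 1)")
      case True
      then show ?thesis by (intro mult_left_mono step) simp_all
    next
      case False
      then show ?thesis by (simp add: set_pmf_iff)
    qed
  qed
  also have "\<dots> = \<delta>"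
    using sum_pmf_eq_1[of "Pow (rsets n r)" "proc n r 1"] set_proc[of 1]
    by (simp only: sum_distrib_right[symmetric]) simp
  finally show ?thesis .
qed

text \<open>After a pair meeting once the conditional probability is exactly \<tau>; on the
  remaining event it differs from \<tau> by at most 1.\<close>

lemma prob_three_star:
  assumes "2 \<le> r" "0 < D" "2 < M"
  shows "\<bar>P 3 {F. is_star n F} - \<tau>\<bar> \<le> \<delta>"
proof -
  let ?U = "Pow (rsets n r)" and ?s = "\<lambda>F. measure_pmf.prob (step n r F) {F. is_star n F}"
  have T: "0 \<le> T"
  proof -
    \<comment> \<open>A concrete pair meeting only in \<open>r\<close> exhibits \<open>T\<close> as
      a cardinality, hence nonnegative.\<close>
    let ?a = "{1..r}" and ?b = "{r..2 * r - 1}"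
    have "?a \<in> rsets n r" "?b \<in> rsets n r" "?a \<inter> ?b = {r}" using r1 rn by (auto simp: rsets_def)
    from card_hitting_pair[OF this] show ?thesis by (metis of_nat_0_le_iff)
  qed
  have \<tau>: "0 \<le> \<tau>" "\<tau> \<le> 1" using T assms(3) by auto
  have "P 3 {F. is_star n F} = (\<Sum>F\<in>?U. pmf (proc n r 2) F * ?s F)"
    using prob_proc_Suc[of 2] by (simp add: numeral_3_eq_3 numeral_2_eq_2)
  moreover have "(\<Sum>F\<in>?U. pmf (proc n r 2) F * \<tau>) = \<tau>"
    using sum_pmf_eq_1[of "Pow (rsets n r)" "proc n r 2"] set_proc[of 2]
    by (simp only: sum_distrib_right[symmetric]) simp
  ultimately have eq: "P 3 {F. is_star n F} - \<tau> = (\<Sum>F\<in>?U. pmf (proc n r 2) F * (?s F - \<tau>))"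
    by (simp only: right_diff_distrib sum_subtractf)
  have "\<bar>P 3 {F. is_star n F} - \<tau>\<bar> \<le> (\<Sum>F\<in>?U. \<bar>pmf (proc n r 2) F * (?s F - \<tau>)\<bar>)"
    unfolding eq by (rule sum_abs)
  also have "\<dots> \<le> (\<Sum>F\<in>?U. pmf (proc n r 2) F * indicator (- pairs_meeting_once) F)"
  proof (rule sum_mono)
    fix F
    have "\<bar>?s F - \<tau>\<bar> \<le> indicator (- pairs_meeting_once) F"
    proof (cases "F \<in> pairs_meeting_once")
      case True
      then obtain a b x where "a \<in> rsets n r" "b \<in> rsets n r" "F = {a, b}" "a \<inter> b = {x}"
        unfolding pairs_meeting_once_def by blast
      then have "?s F = \<tau>" using prob_step_pair[OF assms(1,3), of a b x] by simp
      then show ?thesis by simp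
    next
      case False
      have "0 \<le> ?s F" "?s F \<le> 1" by auto
      then have "\<bar>?s F - \<tau>\<bar> \<le> 1" using \<tau> by linarith
      then show ?thesis using False by simp
    qed
    then show "\<bar>pmf (proc n r 2) F * (?s F - \<tau>)\<bar> \<le> pmf (proc n r 2) F * indicator (- pairs_meeting_once) F"
      unfolding abs_mult by (intro mult_mono) auto
  qed
  also have "\<dots> = P 2 (- pairs_meeting_once)" by (rule prob_proc_sum[symmetric])
  also have "\<dots> \<le> \<delta>" using assms by (intro prob_not_meeting_once)
  finally show ?thesis .
qed

section \<open>Quantitative bounds\<close>

lemma M_ge: "2 \<le> r \<Longrightarrow> n - 1 \<le> M"
  using rn by (intro le_binomial) auto

lemma n_ge: "3 \<le> real n" using rn r1 by auto

lemma N_pos: "0 < real N" using M_pos M_le_N by linarith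

lemma M_over_N: "real M / real N = real r / real n"
proof -
  have "real M / (real n * real M / real r) = real r / real n"
    using M_pos r1 rn by (simp del: zero_less_binomial_iff)
  then show ?thesis unfolding N_eq .
qed

lemma disjoint_ratio_le: "real ((n - r) choose r) / real N \<le> exp (- (real r ^ 2 / real n))"
  using binomial_ratio_le_exp[of r r n] rn by (simp add: power2_eq_square)

lemma D_ge: "real N * (real r ^ 2 / real n / (1 + real r ^ 2 / real n) - 1 / real N) \<le> D"
proof -
  let ?y = "real r ^ 2 / real n"
  have "real ((n - r) choose r) / real N \<le> 1 - ?y / (1 + ?y)"
    using disjoint_ratio_le one_minus_exp_ge[of ?y] by simp
  then have "real ((n - r) choose r) \<le> (1 - ?y / (1 + ?y)) * real N"
    using N_pos by (simp only: pos_divide_le_eq)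
  then show ?thesis using N_pos by (simp add: algebra_simps)
qed

lemma inverse_N_le:
  assumes "2 \<le> r"
  shows "1 / real N \<le> real r / (real n * (real n - 1))"
proof -
  have "real n - 1 \<le> real M" using M_ge[OF assms] rn by linarith
  then have "real n * (real n - 1) / real r \<le> real N"
    unfolding N_eq by (intro divide_right_mono mult_left_mono) auto
  moreover have "0 < real n * (real n - 1) / real r" using assms rn by simp
  ultimately have "1 / real N \<le> 1 / (real n * (real n - 1) / real r)"
    by (intro frac_le) auto
  then show ?thesis by simp
qed

text \<open>With \<open>y = r^2 / n \<le> 1/3\<close>, the main term of \<open>D_ge\<close> is at
  least \<open>3/4 * y\<close> and \<open>1 / N\<close> is at most \<open>y / 4\<close>. What is
  left is \<open>N * y / 2 = r * M / 2\<close>.\<close>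

lemma D_ge_half:
  assumes "2 \<le> r" "3 * real r ^ 2 \<le> real n"
  shows "real r * real M / 2 \<le> D"
proof -
  let ?y = "real r ^ 2 / real n"
  have n0: "0 < real n" using rn by simp
  have y: "0 < ?y" "?y \<le> 1 / 3" using assms n0 by (auto simp: field_simps)
  have "?y * (3 / 4) \<le> ?y / (1 + ?y)"
    using y mult_left_mono[of "3 / 4" "1 / (1 + ?y)" ?y] by (simp add: field_simps)
  moreover have "1 / real N \<le> ?y / 4"
  proof -
    have "1 / real N \<le> real r / (real n * (real n - 1))" using inverse_N_le[OF assms(1)] .
    also have "\<dots> \<le> ?y / 4"
    proof -
      have "2 * 4 \<le> real r * (real n - 1)" using assms(1) rn by (intro mult_mono) auto
      then have "4 * real r \<le> real r * (real r * (real n - 1))" using assms(1) by simp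
      then have "real r / (real n - 1) \<le> real r ^ 2 / 4"
        using n_ge by (subst pos_divide_le_eq) (auto simp: power2_eq_square)
      from divide_right_mono[OF this, of "real n"] show ?thesis by (simp add: mult.commute)
    qed
    finally show ?thesis .
  qed
  ultimately have "real N * (?y / 2) \<le> real N * (?y / (1 + ?y) - 1 / real N)"
    using N_pos by (intro mult_left_mono) auto
  also have "\<dots> \<le> D" by (rule D_ge)
  also have "real N * (?y / 2) = real r * real M / 2"
    unfolding N_eq using r1 rn by (simp add: field_simps power2_eq_square)
  finally show ?thesis .
qed

lemma sparse_bounds:
  assumes "2 \<le> r" "3 * real r ^ 2 \<le> real n"
  shows "0 < D" "\<delta> \<le> 2 * \<rho>" "real n * \<kappa> \<le> 2"
proof -
  note D = D_ge_half[OF assms]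
  have Mp: "1 \<le> real M" using M_pos by linarith
  have rM: "0 < real r * real M" using r1 Mp by (intro mult_pos_pos) linarith+
  then show D0: "0 < D" using D by linarith
  have "\<rho> * (real r - 1) * real M \<le> \<rho> * (real r * real M)"
    using \<rho>_nonneg Mp unfolding mult.assoc by (intro mult_left_mono mult_right_mono) auto
  also have "\<dots> \<le> \<rho> * (2 * D)" using D \<rho>_nonneg by (intro mult_left_mono) auto
  finally show "\<delta> \<le> 2 * \<rho>" using D0 by (simp only: pos_divide_le_eq mult.commute mult.left_commute mult.assoc)
  have "real n * \<kappa> = (real n * real M / real N) * (real M - 1) / D" by simp
  also have "real n * real M / real N = real r"
    using M_over_N rn by (metis (no_types, lifting) nonzero_mult_div_cancel_left times_divide_eq_right gr_implies_not0 of_nat_eq_0_iff)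
  also have "real r * (real M - 1) / D \<le> 2"
  proof -
    have "real r * (real M - 1) \<le> real r * real M" by (intro mult_left_mono) auto
    also have "\<dots> \<le> 2 * D" using D by simp
    finally show ?thesis using D0 by (simp only: pos_divide_le_eq)
  qed
  finally show "real n * \<kappa> \<le> 2" .
qed

lemma binomial_n1_r: "real ((n - 1) choose r) = real M * (real n - real r) / real r"
proof -
  have "real r * real ((n - 1) choose r) = (real n - real r) * real M"
  proof -
    have "r * ((n - 1) choose r) = (n - 1 - (r - 1)) * ((n - 1) choose (r - 1))"
      using binomial_absorb_comp[of "n - 1" "r - 1"] binomial_absorption[of "r - 1" "n - 1"] r1 by simp
    then show ?thesis using r1 rn by (metis (no_types, lifting) Suc_diff_le diff_Suc_Suc One_nat_def Suc_pred less_imp_le_nat less_le_trans mult_2 le_add1 of_nat_diff of_nat_mult order_less_imp_le zero_less_one diff_diff_eq le_add_diff_inverse trans_le_add1)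
  qed
  then show ?thesis using r1 by (simp add: field_simps)
qed

text \<open>Here \<open>\<rho> \<le> 1/16\<close>, so the sum behaves like its term
  \<open>k = 3\<close> with denominators at least \<open>M / 2\<close>. Together with
  \<open>n * \<kappa> \<le> 2\<close> and \<open>(n - 1) choose r \<le> M * n / r\<close>, this is
  of order \<open>r^5 / n^2\<close>, which vanishes when \<open>r\<close> is of order at most the
  cube root of \<open>n\<close>.\<close>

lemma loss_le:
  assumes "2 \<le> r" "32 * real r ^ 2 \<le> real n"
  shows "n * \<kappa> * real ((n - 1) choose r) *
      ((\<Sum>k\<in>{3..<M div 2 + 1}. \<rho> ^ k / (real M - real k)) + \<rho> ^ (M div 2 + 1))
    \<le> 8 * real n * real r ^ 5 / (real n - 1) ^ 3 + 2 * real n * (1 / 2) ^ (n - 1)"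
proof -
  let ?m = "M div 2 + 1"
  note k2 = sparse_bounds(3)[OF assms(1)]
  have r3: "3 * real r ^ 2 \<le> real n" using assms(2) zero_le_power2[of "real r"] by linarith
  have Mp: "1 \<le> real M" using M_pos by linarith
  have \<rho>: "\<rho> \<le> 1 / 16"
  proof -
    have "real r * (real r - 1) \<le> real r ^ 2" by (simp add: power2_eq_square algebra_simps)
    moreover have "real n \<le> 2 * (real n - 1)" using n_ge by simp
    moreover have "16 * a \<le> c - 1" if "a \<le> b" "c \<le> 2 * (c - 1)" "32 * b \<le> c" for a b c :: real
      using that by argo
    ultimately have "16 * (real r * (real r - 1)) \<le> real n - 1" using assms(2) by blast
    then show ?thesis using n_ge by (subst pos_divide_le_eq) auto
  qed
  define p where "p = \<rho>"
  have p0: "0 \<le> p" and p16: "p \<le> 1 / 16" unfolding p_def by (rule \<rho>_nonneg, rule \<rho>)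
  then have p2: "p \<le> 1 / 2" by linarith
  have c: "real n * \<kappa> * real ((n - 1) choose r) \<le> 2 * (real M * real n / real r)"
  proof (rule mult_mono[OF k2[OF r3]])
    show "real ((n - 1) choose r) \<le> real M * real n / real r"
      unfolding binomial_n1_r by (intro divide_right_mono mult_left_mono) auto
  qed auto
  have "(\<Sum>k\<in>{3..<?m}. p ^ k / (real M - real k)) \<le> (\<Sum>k\<in>{3..<?m}. (2 / real M * p ^ 3) * (1 / 2) ^ (k - 3))"
  proof (rule sum_mono)
    fix k assume k: "k \<in> {3..<?m}"
    then have "k \<le> M div 2" by simp
    then have "2 * k \<le> M" by linarith
    then have h: "real M / 2 \<le> real M - real k" by linarith
    have "p ^ k = p ^ 3 * p ^ (k - 3)" using k by (simp add: power_add[symmetric])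
    also have "\<dots> \<le> p ^ 3 * (1 / 2) ^ (k - 3)"
      using p2 p16 p0 by (intro mult_left_mono power_mono zero_le_power) auto
    finally have "p ^ k / (real M - real k) \<le> (p ^ 3 * (1 / 2) ^ (k - 3)) / (real M / 2)"
      using h Mp p0 by (intro frac_le mult_nonneg_nonneg) (simp_all del: zero_less_binomial_iff)
    then show "p ^ k / (real M - real k) \<le> (2 / real M * p ^ 3) * (1 / 2) ^ (k - 3)"
      by (simp add: mult_ac)
  qed
  also have "\<dots> = (2 / real M * p ^ 3) * (\<Sum>k\<in>{3..<?m}. (1 / 2) ^ (k - 3))"
    by (rule sum_distrib_left[symmetric])
  also have "\<dots> \<le> (2 / real M * p ^ 3) * 2"
  proof (rule mult_left_mono)
    have "(\<Sum>k\<in>{3..<?m}. (1 / 2 :: real) ^ (k - 3)) = (\<Sum>j<?m - 3. (1 / 2) ^ j)"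
      by (rule sum.reindex_bij_witness[of _ "\<lambda>j. j + 3" "\<lambda>k. k - 3"]) auto
    also have "\<dots> \<le> 2"
      by (simp add: geometric_sum)
    finally show "(\<Sum>k\<in>{3..<?m}. (1 / 2 :: real) ^ (k - 3)) \<le> 2" .
  qed (use p0 in auto)
  finally have s1: "(\<Sum>k\<in>{3..<?m}. p ^ k / (real M - real k)) \<le> 4 / real M * p ^ 3" by simp
  have s2: "p ^ ?m \<le> (1 / 2) ^ (n - 1) / real M"
  proof -
    \<comment> \<open>\<open>1/16 = (1/4)^2\<close> makes up for halving the exponent, leaving
      \<open>(1/4) ^ M\<close>. One factor \<open>(1/2) ^ M\<close> yields the decay in
      \<open>n\<close>, the other cancels the \<open>M\<close> of the prefactor.\<close>
    have "p ^ ?m \<le> (1 / 16) ^ ?m" using p2 p16 p0 by (intro power_mono) auto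
    also have "\<dots> = (1 / 4) ^ (2 * ?m)" by (simp add: power_mult power2_eq_square)
    also have "\<dots> \<le> (1 / 4) ^ M" by (intro power_decreasing) auto
    also have "\<dots> = (1 / 2) ^ M * (1 / 2) ^ M" by (simp add: power_mult_distrib[symmetric])
    also have "\<dots> \<le> (1 / 2) ^ (n - 1) * (1 / real M)"
    proof (rule mult_mono)
      show "(1 / 2 :: real) ^ M \<le> (1 / 2) ^ (n - 1)" using M_ge[OF assms(1)] by (intro power_decreasing) auto
      have M2: "real M < 2 ^ M" by (rule of_nat_less_two_power)
      have "1 / 2 ^ M \<le> 1 / real M" by (rule frac_le) (use M2 Mp in linarith)+
      then show "(1 / 2) ^ M \<le> 1 / real M" by (simp only: power_one_over)
    qed auto
    finally show ?thesis by simp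
  qed
  have "n * \<kappa> * real ((n - 1) choose r) *
      ((\<Sum>k\<in>{3..<?m}. p ^ k / (real M - real k)) + p ^ ?m)
    \<le> 2 * (real M * real n / real r) * (4 / real M * p ^ 3 + (1 / 2) ^ (n - 1) / real M)"
  proof (rule mult_mono[OF c add_mono[OF s1 s2]])
    show "0 \<le> (\<Sum>k\<in>{3..<?m}. p ^ k / (real M - real k)) + p ^ ?m"
    proof (intro add_nonneg_nonneg sum_nonneg zero_le_power p0 divide_nonneg_nonneg)
      fix k assume "k \<in> {3..<?m}"
      then have "k \<le> M" by auto
      then show "0 \<le> real M - real k" by simp
    qed
  qed auto
  also have "\<dots> = 8 * (real n / real r) * p ^ 3 + 2 * (real n / real r) * (1 / 2) ^ (n - 1)"
  proof -
    have "2 * (a * b / c) * (4 / a * w + z / a) = 8 * (b / c) * w + 2 * (b / c) * z" if "a \<noteq> 0" for a b c w z :: real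
      using that by (cases "c = 0") (simp_all add: field_simps)
    from this[of "real M"] show ?thesis using Mp by (metis not_one_le_zero)
  qed
  also have "8 * (real n / real r) * p ^ 3 \<le> 8 * real n * real r ^ 5 / (real n - 1) ^ 3"
  proof -
    have "p \<le> real r ^ 2 / (real n - 1)"
      unfolding p_def using n_ge by (intro divide_right_mono) (auto simp: power2_eq_square intro!: mult_left_mono)
    then have "p ^ 3 \<le> (real r ^ 2 / (real n - 1)) ^ 3"
      using p0 by (intro power_mono)
    then have "8 * (real n / real r) * p ^ 3 \<le> 8 * (real n / real r) * (real r ^ 2 / (real n - 1)) ^ 3"
      by (intro mult_left_mono) auto
    also have "\<dots> = 8 * real n * real r ^ 5 / (real n - 1) ^ 3"
      using r1 by (simp add: power_divide field_simps eval_nat_numeral)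
    finally show ?thesis .
  qed
  also have "2 * (real n / real r) * (1 / 2) ^ (n - 1) \<le> 2 * real n * (1 / 2) ^ (n - 1)"
    using r1 divide_left_mono[of 1 "real r" "real n"] by (intro mult_right_mono) auto
  finally show ?thesis unfolding p_def by simp
qed

text \<open>The star probability after three sets is within \<open>2 * \<rho>\<close> of \<tau>. It
  bounds \<open>probE\<close> from above by monotonicity, and from below after subtracting the later
  losses.\<close>

lemma probE_near_\<tau>:
  assumes "2 \<le> r" "32 * real r ^ 2 \<le> real n"
  shows "probE n r \<le> \<tau> + 2 * \<rho>"
    and "\<tau> - 2 * \<rho> - (8 * real n * real r ^ 5 / (real n - 1) ^ 3 + 2 * real n * (1 / 2) ^ (n - 1)) \<le> probE n r"
proof -
  have r3: "3 * real r ^ 2 \<le> real n" using assms(2) zero_le_power2[of "real r"] by linarith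
  have "2 ^ 2 \<le> real r ^ 2" using assms(1) by (intro power_mono) auto
  then have "128 \<le> n" using assms(2) by simp
  then have M4: "4 \<le> M" using M_ge[OF assms(1)] by simp
  have t: "\<bar>P 3 {F. is_star n F} - \<tau>\<bar> \<le> 2 * \<rho>"
    using prob_three_star[OF assms(1) sparse_bounds(1)[OF assms(1) r3]] sparse_bounds(2)[OF assms(1) r3] M4 by linarith
  have "probE n r \<le> P 3 {F. is_star n F}"
    using assms(1) M4 M_le_N by (intro probE_le_star) auto
  then show "probE n r \<le> \<tau> + 2 * \<rho>" using t by linarith
  show "\<tau> - 2 * \<rho> - (8 * real n * real r ^ 5 / (real n - 1) ^ 3 + 2 * real n * (1 / 2) ^ (n - 1)) \<le> probE n r"
    using probE_ge_star[OF assms(1) sparse_bounds(1)[OF assms(1) r3] M4] loss_le[OF assms] t by linarith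
qed

text \<open>Among \<open>r\<close>-sets avoiding \<open>x\<close>, \<open>u\<close> is the fraction
  missing the other \<open>r - 1\<close> points of the first set, and \<open>v\<close> the fraction
  missing those of both. So \<open>T\<close> is \<open>(n - 1) choose r\<close> times
  \<open>1 - 2 * u + v\<close>, which is close to \<open>(1 - u)^2\<close>, about
  \<open>\<rho>^2\<close>; with \<open>((n - 1) choose r) / M = (n - r) / r\<close> the ratio is
  about \<open>r^3 / n\<close>.\<close>

lemma T_over_M:
  assumes "3 * r \<le> n"
  shows "T / real M \<le> (real n - real r) / real r * (real r * (real r - 1) / (real n - 1 - real r))\<^sup>2"
    and "(real n - real r) / real r * ((\<rho> / (1 + \<rho>))\<^sup>2 - real r * ((real r - 1) / (real n - 1 - real r))\<^sup>2) \<le> T / real M"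
proof -
  let ?B = "real ((n - 1) choose r)"
  define u where "u = real ((n - 1 - (r - 1)) choose r) / ?B"
  define v where "v = real ((n - 1 - 2 * (r - 1)) choose r) / ?B"
  have Bpos: "0 < ?B" using rn r1 by simp
  have Mp: "0 < real M" using M_pos by linarith
  have q: "0 < (real n - real r) / real r" using r1 rn by simp
  have h: "2 * (r - 1) + r \<le> n - 1" "r < n - 1" "(r - 1) + r \<le> n - 1" using assms r1 rn by auto
  have cast: "real (n - 1) = real n - 1" "real (r - 1) = real r - 1" using r1 rn by auto
  have "n - 1 - (r - 1) = n - r" "n - 1 - 2 * (r - 1) = n + 1 - 2 * r" using r1 rn by auto
  then have "T = ?B * (1 - 2 * u + v)"
    unfolding u_def v_def using Bpos by (simp add: field_simps)
  also have "\<dots> = real M * ((real n - real r) / real r * ((1 - u)\<^sup>2 - (u\<^sup>2 - v)))"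
  proof -
    have "(1 - u)\<^sup>2 - (u\<^sup>2 - v) = 1 - 2 * u + v" by (simp add: power2_eq_square algebra_simps)
    then show ?thesis unfolding binomial_n1_r by simp
  qed
  finally have TM: "T / real M = (real n - real r) / real r * ((1 - u)\<^sup>2 - (u\<^sup>2 - v))"
    using Mp by simp
  have uv: "v \<le> u\<^sup>2" "u\<^sup>2 - v \<le> real r * ((real r - 1) / (real n - 1 - real r))\<^sup>2"
    using binomial_ratio_square_diff[OF h(1,2)] unfolding u_def v_def cast by auto
  have "u \<le> exp (- \<rho>)" using binomial_ratio_le_exp[OF h(3)] unfolding u_def cast by simp
  then have lo: "\<rho> / (1 + \<rho>) \<le> 1 - u" using one_minus_exp_ge[OF \<rho>_nonneg] by linarith
  have hi: "1 - u \<le> real r * (real r - 1) / (real n - 1 - real r)"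
    using binomial_ratio_ge[OF h(3,2)] unfolding u_def cast by simp
  have lo0: "0 \<le> \<rho> / (1 + \<rho>)" using \<rho>_nonneg divide_nonneg_nonneg[OF \<rho>_nonneg, of "1 + \<rho>"] by linarith
  have sq: "(\<rho> / (1 + \<rho>))\<^sup>2 \<le> (1 - u)\<^sup>2" "(1 - u)\<^sup>2 \<le> (real r * (real r - 1) / (real n - 1 - real r))\<^sup>2"
    using lo hi lo0 by (auto intro!: power_mono)
  show "T / real M \<le> (real n - real r) / real r * (real r * (real r - 1) / (real n - 1 - real r))\<^sup>2"
    unfolding TM using sq uv q by (intro mult_left_mono) auto
  show "(real n - real r) / real r * ((\<rho> / (1 + \<rho>))\<^sup>2 - real r * ((real r - 1) / (real n - 1 - real r))\<^sup>2) \<le> T / real M"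
    unfolding TM using sq uv q by (intro mult_left_mono) auto
qed

text \<open>Up to constants, \<open>q = min 1 (r^2 / n)\<close> is the probability that two random
  \<open>r\<close>-sets meet. The second and third choices have at least \<open>N * q / 4\<close>
  and \<open>N * q^2 / 8\<close> options, so the expected number of common points is at most
  \<open>n * (r / n)^3 * 32 / q^3\<close>; the two summands of the bound are the cases
  \<open>q = y\<close> and \<open>q = 1\<close>.\<close>

lemma probE_le_middle:
  assumes "64 \<le> r" "64 * real r ^ 3 \<le> real n ^ 2"
  shows "probE n r \<le> 32 * (real n / real r ^ 3 + real r ^ 3 / real n ^ 2)"
proof -
  define y where "y = real r ^ 2 / real n"
  define q where "q = min 1 y"
  define u where "u = real ((n - r) choose r) / real N"
  define v where "v = real ((n - 2 * r) choose r) / real N"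
  define A2 where "A2 = real N - 2 * real ((n - r) choose r) + real ((n - 2 * r) choose r) - 2"
  have r0: "0 < real r" "64 \<le> real r" and n0: "0 < real n" "1 < real n" and nr: "2 * real r < real n"
    using assms rn by linarith+
  have y0: "0 < y" unfolding y_def using r0 n0 by simp
  have q0: "0 < q" "q \<le> 1" "q \<le> y" unfolding q_def using y0 by auto
  have "q / 2 \<le> y / (1 + y)"
  proof (cases "y \<le> 1")
    case True
    then have "y * (1 / 2) \<le> y * (1 / (1 + y))" using y0 by (intro mult_left_mono divide_left_mono) auto
    then show ?thesis using True by (simp add: q_def)
  next
    case False
    then show ?thesis by (simp add: q_def field_simps)
  qed
  then have u1: "q / 2 \<le> 1 - u"
    using disjoint_ratio_le[folded u_def y_def] one_minus_exp_ge[of y] y0 by linarith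
  have iN: "1 / real N \<le> 2 * (real r / real n ^ 2)"
  proof -
    have "1 / real N \<le> real r / (real n * (real n - 1))" using inverse_N_le assms by simp
    also have "\<dots> \<le> real r / (real n * (real n / 2))"
      using n0 r0 nr by (intro divide_left_mono mult_left_mono mult_pos_pos) auto
    finally show ?thesis by (simp add: power2_eq_square mult.commute)
  qed
  \<comment> \<open>The error \<open>u^2 - v\<close> will be of order \<open>r^3 / n^2\<close> and
    has to be small against \<open>q^2\<close>: for \<open>y \<le> 1\<close> this is where
    \<open>64 \<le> r\<close> enters, otherwise the second hypothesis.\<close>
  have r3q: "real r ^ 3 / real n ^ 2 \<le> q ^ 2 / 64"
  proof (cases "y \<le> 1")
    case True
    have "64 * real r ^ 3 \<le> real r ^ 4" using r0 by (simp add: eval_nat_numeral)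
    then have "64 * real r ^ 3 / real n ^ 2 \<le> real r ^ 4 / real n ^ 2" by (intro divide_right_mono) auto
    also have "\<dots> = q ^ 2" using True by (simp add: q_def y_def power_divide)
    finally show ?thesis by (simp add: mult.commute)
  next
    case False
    then have "q = 1" by (simp add: q_def)
    then show ?thesis using assms(2) n0 by (simp add: field_simps)
  qed
  have rq: "real r / real n ^ 2 \<le> q ^ 2 / 256"
  proof -
    have "4 * real r \<le> real r ^ 3"
    proof -
      have "real r * 4 \<le> real r * real r ^ 2"
        using r0 power_mono[of 2 "real r" 2] by (intro mult_left_mono) auto
      then show ?thesis by (simp add: eval_nat_numeral)
    qed
    from divide_right_mono[OF this, of "real n ^ 2"]
    have "4 * (real r / real n ^ 2) \<le> real r ^ 3 / real n ^ 2" by simp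
    then show ?thesis using r3q by argo
  qed
  have q2: "q ^ 2 \<le> q" using q0 by (simp add: power2_eq_square)
  have Dq: "real N * (q / 4) \<le> D"
  proof -
    have "q / 4 \<le> 1 - u - 1 / real N" using u1 iN rq q2 q0(1) by linarith
    then have "real N * (q / 4) \<le> real N * (1 - u - 1 / real N)" using N_pos by (intro mult_left_mono) auto
    also have "\<dots> = D" unfolding u_def using N_pos by (simp add: field_simps)
    finally show ?thesis .
  qed
  have Aq: "real N * (q ^ 2 / 8) \<le> A2"
  proof -
    have "3 * real r \<le> real n"
    proof -
      have "(3 * real r) ^ 2 \<le> real n ^ 2"
      proof -
        have "9 * real r ^ 2 \<le> (64 * real r) * real r ^ 2" using r0 by (intro mult_right_mono) auto
        then show ?thesis using assms(2) by (simp add: power_mult_distrib eval_nat_numeral)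
      qed
      then show ?thesis by (rule power2_le_imp_le) simp
    qed
    then have "u\<^sup>2 - v \<le> real r * (real r / (real n - real r))\<^sup>2"
      unfolding u_def v_def using rn by (intro binomial_ratio_square_diff(2)) auto
    also have "\<dots> \<le> real r * (real r / (real n / 2))\<^sup>2"
      using nr n0 r0 by (intro mult_left_mono power_mono divide_left_mono) auto
    also have "\<dots> = 4 * (real r ^ 3 / real n ^ 2)"
      by (simp add: power_divide power_mult_distrib eval_nat_numeral)
    finally have uv: "u\<^sup>2 - v \<le> q ^ 2 / 16" using r3q by linarith
    have "(q / 2)\<^sup>2 \<le> (1 - u)\<^sup>2" using u1 q0 by (intro power_mono) auto
    then have "q ^ 2 / 4 \<le> (1 - u)\<^sup>2" by (simp add: power_divide)
    moreover have "2 * (1 / real N) \<le> q ^ 2 / 64" using iN rq by linarith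
    ultimately have "q ^ 2 / 8 \<le> (1 - u)\<^sup>2 - (u\<^sup>2 - v) - 2 * (1 / real N)"
      using uv zero_le_power2[of q] by linarith
    then have "real N * (q ^ 2 / 8) \<le> real N * ((1 - u)\<^sup>2 - (u\<^sup>2 - v) - 2 * (1 / real N))"
      using N_pos by (intro mult_left_mono) auto
    also have "(1 - u)\<^sup>2 - (u\<^sup>2 - v) - 2 * (1 / real N) = 1 - 2 * u + v - 2 * (1 / real N)"
      by (simp add: power2_eq_square algebra_simps)
    also have "real N * \<dots> = A2" unfolding u_def v_def A2_def using N_pos by (simp add: field_simps)
    finally show ?thesis .
  qed
  define a :: "nat \<Rightarrow> real" where "a i = (if i = 0 then N else if i = 1 then D else A2)" for i
  have pos: "0 < real N" "0 < D" "0 < A2"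
  proof -
    have "0 < real N * (q / 4)" "0 < real N * (q ^ 2 / 8)" using N_pos q0 by (auto intro!: mult_pos_pos simp del: zero_less_binomial_iff)
    with Dq Aq N_pos show "0 < real N" "0 < D" "0 < A2" by (meson less_le_trans)+
  qed
  have M3: "3 \<le> M" using M_ge assms rn by simp
  have "probE n r \<le> P 3 {F. is_star n F}"
    using M3 M_le_N assms by (intro probE_le_star) auto
  also have "\<dots> \<le> n * (\<Prod>i<3. M / a i)"
  proof (rule prob_star_le[OF M3])
    fix x i G assume i: "i < (3::nat)" and G: "G \<subseteq> Star n r x" "card G = i"
    have fG: "finite G" using G(1) by (rule finite_subset) simp
    have GR: "G \<subseteq> rsets n r" using G by (auto simp: Star_def)
    consider "i = 0" | "i = 1" | "i = 2" using i by linarith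
    then show "a i \<le> card (avail n r G)"
    proof cases
      case 1
      then have "G = {}" using G fG by simp
      then show ?thesis using 1 by (simp add: a_def card_avail_empty)
    next
      case 2
      then obtain b where b: "G = {b}" using G by (auto simp: card_1_singleton_iff)
      then show ?thesis using 2 card_avail_single[of b] GR by (simp add: a_def)
    next
      case 3
      then obtain b c where "G = {b, c}" using G by (auto simp: card_2_iff)
      then show ?thesis using 3 card_avail_pair[of b c] GR by (simp add: a_def A2_def)
    qed
  qed (use pos in \<open>auto simp: a_def\<close>)
  also have "(\<Prod>i<3. M / a i) = (real M / real N) * (real M / D) * (real M / A2)"
    by (simp add: eval_nat_numeral a_def)
  also have "\<dots> \<le> (real M / real N) * (real M / (real N * (q / 4))) * (real M / (real N * (q ^ 2 / 8)))"
    using Dq Aq pos q0 by (intro mult_mono divide_left_mono mult_nonneg_nonneg mult_pos_pos) auto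
  also have "\<dots> = (real M / real N) * (real M / real N) * (real M / real N) * (32 / q ^ 3)"
    by (simp add: eval_nat_numeral mult_ac)
  also have "\<dots> = 32 * (real r / real n) ^ 3 / q ^ 3"
    unfolding M_over_N by (simp add: eval_nat_numeral mult_ac)
  finally have *: "probE n r \<le> real n * (32 * (real r / real n) ^ 3 / q ^ 3)"
    by (simp add: mult_left_mono)
  show ?thesis
  proof (cases "y \<le> 1")
    case True
    then have "real n * (32 * (real r / real n) ^ 3 / q ^ 3) = 32 * (real n / real r ^ 3)"
      using r0 n0 by (simp add: q_def y_def field_simps eval_nat_numeral)
    then show ?thesis using * r0 n0 by (simp add: add_increasing2)
  next
    case False
    then have "real n * (32 * (real r / real n) ^ 3 / q ^ 3) = 32 * (real r ^ 3 / real n ^ 2)"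
      using r0 n0 by (simp add: q_def field_simps eval_nat_numeral)
    then show ?thesis using * r0 n0 by (simp add: add_increasing)
  qed
qed

text \<open>The hypothesis ensures that fewer than \<open>n\<close> members exclude at most a tenth
  of all \<open>r\<close>-sets. Each of the first \<open>n - 1\<close> choices then contributes a
  factor at most \<open>10/9 * r / n \<le> 5/9\<close>; the number \<open>n - 1\<close> is
  admissible because \<open>M_ge\<close> bounds \<open>M\<close> below by it.\<close>

lemma probE_le_large:
  assumes "2 \<le> r" "real n * (exp (- (real r ^ 2 / real n)) + 1 / 2 ^ r) \<le> 1 / 10"
  shows "probE n r \<le> real n * (5 / 9) ^ (n - 1)"
proof -
  define w where "w = real ((n - r) choose r)"
  have kM: "n - 1 \<le> M" using M_ge assms by simp
  have w: "w \<le> exp (- (real r ^ 2 / real n)) * real N"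
    using disjoint_ratio_le N_pos unfolding w_def by (simp only: pos_divide_le_eq)
  have "2 ^ r \<le> real N" using two_power_le_binomial[of r n] rn by simp
  then have N1: "1 \<le> 1 / 2 ^ r * real N" by (simp add: field_simps)
  have nw: "real n * (w + 1) \<le> real N / 10"
  proof -
    have "real n * (w + 1) \<le> real n * (exp (- (real r ^ 2 / real n)) * real N + 1 / 2 ^ r * real N)"
      using w N1 by (intro mult_left_mono add_mono) simp_all
    also have "\<dots> = real n * (exp (- (real r ^ 2 / real n)) + 1 / 2 ^ r) * real N"
      by (simp add: algebra_simps)
    also have "\<dots> \<le> 1 / 10 * real N" using assms(2) N_pos by (intro mult_right_mono) auto
    finally show ?thesis by simp
  qed
  have "probE n r \<le> P (n - 1) {F. is_star n F}"
    using kM M_le_N assms by (intro probE_le_star) auto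
  also have "\<dots> \<le> n * (\<Prod>i<n - 1. M / (9 / 10 * real N))"
  proof (rule prob_star_le[OF kM])
    fix x i G assume i: "i < n - 1" and G: "G \<subseteq> Star n r x" "card G = i"
    have GR: "G \<subseteq> rsets n r" using G by (auto simp: Star_def)
    have "real i * (w + 1) \<le> real n * (w + 1)" using i by (intro mult_right_mono) (auto simp: w_def)
    then show "9 / 10 * real N \<le> card (avail n r G)"
      using card_avail_ge[OF GR, folded w_def] nw unfolding G(2) by linarith
  qed (use N_pos in simp)
  also have "real M / (9 / 10 * real N) = 10 / 9 * (real r / real n)"
    unfolding M_over_N[symmetric] by simp
  also have "n * (\<Prod>i<n - 1. 10 / 9 * (real r / real n)) \<le> n * (\<Prod>i<n - 1. 5 / 9)"
  proof (intro mult_left_mono prod_mono)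
    have "real r / real n \<le> 1 / 2" using rn by (simp add: field_simps)
    then show "0 \<le> 10 / 9 * (real r / real n) \<and> 10 / 9 * (real r / real n) \<le> 5 / 9" by simp
  qed simp
  finally show ?thesis by simp
qed

end

section \<open>Limits\<close>

text \<open>Substituting \<open>n = w^3\<close> and \<open>r = x * w\<close> turns the bounds into
  rational functions of \<open>x\<close> and \<open>1 / w\<close>, whose limits for \<open>x\<close>
  tending to \<open>c\<close> and \<open>1 / w\<close> tending to 0 are found by evaluation. The
  other rescaling lemmas do the same.\<close>

lemma rescaled_upper:
  fixes w x :: real
  assumes "w \<noteq> 0" "x \<noteq> 0"
  shows "(w^3 - x * w) / (x * w) * ((x * w) * (x * w - 1) / (w^3 - 1 - x * w))\<^sup>2 =
    (1 - x * (1/w)^2) * x * (x - 1/w)^2 / (1 - (1/w)^3 - x * (1/w)^2)^2"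
proof -
  have e: "w^3 - x * w = w^3 * (1 - x * (1/w)^2)" "x * w - 1 = w * (x - 1/w)"
    "w^3 - 1 - x * w = w^3 * (1 - (1/w)^3 - x * (1/w)^2)"
    using assms by (simp_all add: field_simps eval_nat_numeral)
  \<comment> \<open>For \<open>C = 0\<close> both sides are 0 because division by zero gives
    0.\<close>
  have "w^3 * A / (x * w) * ((x * w) * (w * B) / (w^3 * C))\<^sup>2 = A * x * B^2 / C^2" for A B C
    using assms by (cases "C = 0") (simp_all add: field_simps eval_nat_numeral)
  then show ?thesis unfolding e .
qed

lemma rescaled_error:
  fixes w x :: real
  assumes "w \<noteq> 0" "x \<noteq> 0"
  shows "(w^3 - x * w) / (x * w) * ((x * w) * ((x * w - 1) / (w^3 - 1 - x * w))\<^sup>2) =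
    (1/w) * (1 - x * (1/w)^2) * (x - 1/w)^2 / (1 - (1/w)^3 - x * (1/w)^2)^2"
proof -
  have e: "w^3 - x * w = w^3 * (1 - x * (1/w)^2)" "x * w - 1 = w * (x - 1/w)"
    "w^3 - 1 - x * w = w^3 * (1 - (1/w)^3 - x * (1/w)^2)"
    using assms by (simp_all add: field_simps eval_nat_numeral)
  have "w^3 * A / (x * w) * ((x * w) * ((w * B) / (w^3 * C))\<^sup>2) = (1/w) * A * B^2 / C^2" for A B C
    using assms by (cases "C = 0") (simp_all add: field_simps eval_nat_numeral)
  then show ?thesis unfolding e .
qed

lemma rescaled_rho:
  fixes w x :: real
  assumes "w \<noteq> 0"
  shows "(x * w) * (x * w - 1) / (w^3 - 1) = x * (x - 1/w) * (1/w) / (1 - (1/w)^3)"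
proof -
  have e: "x * w - 1 = w * (x - 1/w)" "w^3 - 1 = w^3 * (1 - (1/w)^3)"
    using assms by (simp_all add: field_simps eval_nat_numeral)
  have "(x * w) * (w * B) / (w^3 * C) = x * B * (1/w) / C" for B C
    using assms by (cases "C = 0") (simp_all add: field_simps eval_nat_numeral)
  then show ?thesis unfolding e .
qed

lemma rescaled_lower:
  fixes w x :: real
  assumes "w \<noteq> 0" "x \<noteq> 0"
  shows "(w^3 - x * w) / (x * w) * ((x * w) * (x * w - 1) / (w^3 - 1))\<^sup>2 =
    (1 - x * (1/w)^2) * x * (x - 1/w)^2 / (1 - (1/w)^3)^2"
proof -
  have e: "w^3 - x * w = w^3 * (1 - x * (1/w)^2)" "x * w - 1 = w * (x - 1/w)"
    "w^3 - 1 = w^3 * (1 - (1/w)^3)"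
    using assms by (simp_all add: field_simps eval_nat_numeral)
  have "w^3 * A / (x * w) * ((x * w) * (w * B) / (w^3 * C))\<^sup>2 = A * x * B^2 / C^2" for A B C
    using assms by (cases "C = 0") (simp_all add: field_simps eval_nat_numeral)
  then show ?thesis unfolding e .
qed

lemma rescaled_loss:
  fixes w x :: real
  assumes "w \<noteq> 0"
  shows "8 * w^3 * (x * w)^5 / (w^3 - 1)^3 = 8 * (1/w) * x^5 / (1 - (1/w)^3)^3"
proof -
  have e: "w^3 - 1 = w^3 * (1 - (1/w)^3)"
    using assms by (simp add: field_simps eval_nat_numeral)
  have "8 * w^3 * (x * w)^5 / (w^3 * C)^3 = 8 * (1/w) * x^5 / C^3" for C
    using assms by (cases "C = 0") (simp_all add: field_simps eval_nat_numeral)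
  then show ?thesis unfolding e .
qed


section \<open>Limits of the success probability\<close>

lemma probE_nonneg: "0 \<le> probE n r" and probE_le_1: "probE n r \<le> 1"
  by (simp_all add: probE_def)

text \<open>The estimates assume \<open>2 \<le> r\<close>. For \<open>r = 1\<close> distinct sets
  are disjoint, so the process stops with one set, and \<open>M = 1\<close>.\<close>

lemma probE_singletons:
  assumes "3 \<le> n" shows "probE n 1 = 1"
proof -
  interpret intersecting_process n 1 by unfold_locales (use assms in auto)
  have "card F = 1" if F: "F \<in> set_pmf (process n 1)" for F
  proof -
    have inv: "F \<subseteq> rsets n 1" "\<forall>e\<in>F. \<forall>f\<in>F. e \<inter> f \<noteq> {}"
      using proc_invariant[OF F[unfolded process_eq]] by auto
    have "{1} \<in> rsets n 1" using assms by (auto simp: rsets_def)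
    then have "avail n 1 {} \<noteq> {}" unfolding avail_def by blast
    then have "F \<noteq> {}" using process_halted[OF F] by auto
    then obtain e where e: "e \<in> F" by blast
    have "f = e" if "f \<in> F" for f
    proof -
      have "card e = 1" "card f = 1" using inv(1) e that by (auto simp: rsets_def)
      then obtain a b where "e = {a}" "f = {b}" by (metis card_1_singletonE)
      then show ?thesis using inv(2) e that by force
    qed
    then have "F = {e}" using e by blast
    then show ?thesis by simp
  qed
  then have "AE F in process n 1. F \<in> {F. card F = (n - 1) choose (1 - 1)}"
    by (auto simp: AE_measure_pmf_iff)
  then show ?thesis unfolding probE_def by (intro measure_pmf.prob_eq_1[THEN iffD2]) auto
qed

text \<open>Sandwich with \<open>probE_near_\<tau>\<close>: the error terms vanish, and \<tau>
  converges because \<open>T / M\<close> tends to \<open>c^3\<close>. Admitting \<open>c = 0\<close>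
  also serves the subcritical regime.\<close>

lemma probE_limit_critical:
  fixes r :: "nat \<Rightarrow> nat" and c :: real
  assumes ev: "\<forall>\<^sub>F n in sequentially. 2 \<le> r n \<and> 2 * r n < n"
    and lim: "(\<lambda>n. real (r n) / real n powr (1/3)) \<longlonglongrightarrow> c" and c: "0 \<le> c"
  shows "(\<lambda>n. probE n (r n)) \<longlonglongrightarrow> 1 / (1 + c ^ 3)"
proof -
  define W where "W n = real n powr (1/3)" for n :: nat
  define X where "X n = real (r n) / W n" for n
  define \<rho> where "\<rho> n = real (r n) * (real (r n) - 1) / (real n - 1)" for n
  define M where "M n = real ((n - 1) choose (r n - 1))" for n
  define T where "T n = real ((n - 1) choose r n) - 2 * real ((n - r n) choose r n) + real ((n + 1 - 2 * r n) choose r n)" for n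
  define \<tau> where "\<tau> n = (M n - 2) / (M n - 2 + T n)" for n
  define err where "err n = 8 * real n * real (r n) ^ 5 / (real n - 1) ^ 3 + 2 * real n * (1 / 2) ^ (n - 1)" for n
  have X: "X \<longlonglongrightarrow> c" using lim by (simp add: X_def[abs_def] W_def)
  have iW: "(\<lambda>n. 1 / W n) \<longlonglongrightarrow> 0" unfolding W_def by real_asymp
  have base: "\<forall>\<^sub>F n in sequentially. W n \<noteq> 0 \<and> X n \<noteq> 0 \<and> real n = W n ^ 3 \<and> real (r n) = X n * W n"
    using ev eventually_gt_at_top[of 0]
  proof eventually_elim
    case (elim n)
    have "W n ^ 3 = real n powr (real 3 * (1/3))"
      unfolding W_def using elim by (simp add: powr_realpow[symmetric] powr_powr)
    then have "W n ^ 3 = real n" using elim by simp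
    moreover have "W n \<noteq> 0" using elim by (simp add: W_def)
    ultimately show ?case using elim by (simp add: X_def)
  qed
  note lims = X iW tendsto_const
  have \<rho>0: "\<rho> \<longlonglongrightarrow> 0"
  proof (rule Lim_transform_eventually)
    show "(\<lambda>n. X n * (X n - 1 / W n) * (1 / W n) / (1 - (1 / W n) ^ 3)) \<longlonglongrightarrow> 0"
      by (rule tendsto_eq_intros lims | simp)+
    show "\<forall>\<^sub>F n in sequentially. X n * (X n - 1 / W n) * (1 / W n) / (1 - (1 / W n) ^ 3) = \<rho> n"
      using base by eventually_elim (auto simp: \<rho>_def rescaled_rho)
  qed
  have err0: "err \<longlonglongrightarrow> 0"
  proof -
    have "(\<lambda>n. 8 * real n * real (r n) ^ 5 / (real n - 1) ^ 3) \<longlonglongrightarrow> 0"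
    proof (rule Lim_transform_eventually)
      show "(\<lambda>n. 8 * (1 / W n) * X n ^ 5 / (1 - (1 / W n) ^ 3) ^ 3) \<longlonglongrightarrow> 0"
        by (rule tendsto_eq_intros lims | simp)+
      show "\<forall>\<^sub>F n in sequentially. 8 * (1 / W n) * X n ^ 5 / (1 - (1 / W n) ^ 3) ^ 3 =
          8 * real n * real (r n) ^ 5 / (real n - 1) ^ 3"
        using base by eventually_elim (metis rescaled_loss)
    qed
    moreover have "(\<lambda>n. 2 * real n * (1 / 2) ^ (n - 1)) \<longlonglongrightarrow> 0" by real_asymp
    ultimately show ?thesis unfolding err_def using tendsto_add by fastforce
  qed
  have small: "\<forall>\<^sub>F n in sequentially. 32 * real (r n) ^ 2 \<le> real n"
  proof -
    have "(\<lambda>n. X n ^ 2 * (1 / W n)) \<longlonglongrightarrow> 0"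
      by (rule tendsto_eq_intros lims | simp)+
    then have "\<forall>\<^sub>F n in sequentially. X n ^ 2 * (1 / W n) < 1 / 32" by (rule order_tendstoD) simp
    moreover have "\<forall>\<^sub>F n in sequentially. 0 < W n"
      using eventually_gt_at_top[of 0] by eventually_elim (simp add: W_def)
    ultimately show ?thesis using base
    proof eventually_elim
      case (elim n)
      then have "32 * X n ^ 2 * W n ^ 2 \<le> W n * W n ^ 2"
        by (intro mult_right_mono) (auto simp: field_simps)
      then show ?case using elim by (simp add: power_mult_distrib eval_nat_numeral)
    qed
  qed
  have proc: "\<forall>\<^sub>F n in sequentially. intersecting_process n (r n) \<and> 2 \<le> r n \<and> 3 * r n \<le> n \<and> 32 * real (r n) ^ 2 \<le> real n"
    using ev small
  proof eventually_elim
    case (elim n)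
    have "3 * real (r n) \<le> 32 * real (r n) ^ 2"
      using elim by (simp add: power2_eq_square)
    then have "3 * r n \<le> n" using elim by linarith
    then show ?case using elim by (auto simp: intersecting_process_def)
  qed
  have TM: "(\<lambda>n. T n / M n) \<longlonglongrightarrow> c ^ 3"
  proof (rule tendsto_sandwich)
    show "\<forall>\<^sub>F n in sequentially. (real n - real (r n)) / real (r n) *
        ((\<rho> n / (1 + \<rho> n))\<^sup>2 - real (r n) * ((real (r n) - 1) / (real n - 1 - real (r n)))\<^sup>2) \<le> T n / M n"
      using proc by eventually_elim (use intersecting_process.T_over_M(2) in \<open>auto simp: T_def M_def \<rho>_def\<close>)
    show "\<forall>\<^sub>F n in sequentially. T n / M n \<le> (real n - real (r n)) / real (r n) *
        (real (r n) * (real (r n) - 1) / (real n - 1 - real (r n)))\<^sup>2"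
      using proc by eventually_elim (use intersecting_process.T_over_M(1) in \<open>auto simp: T_def M_def\<close>)
    show "(\<lambda>n. (real n - real (r n)) / real (r n) *
        (real (r n) * (real (r n) - 1) / (real n - 1 - real (r n)))\<^sup>2) \<longlonglongrightarrow> c ^ 3"
    proof (rule Lim_transform_eventually)
      show "(\<lambda>n. (1 - X n * (1 / W n)^2) * X n * (X n - 1 / W n)^2 / (1 - (1 / W n)^3 - X n * (1 / W n)^2)^2) \<longlonglongrightarrow> c ^ 3"
        by (rule tendsto_eq_intros lims | simp add: eval_nat_numeral)+
      show "\<forall>\<^sub>F n in sequentially. (1 - X n * (1 / W n)^2) * X n * (X n - 1 / W n)^2 / (1 - (1 / W n)^3 - X n * (1 / W n)^2)^2
         = (real n - real (r n)) / real (r n) * (real (r n) * (real (r n) - 1) / (real n - 1 - real (r n)))\<^sup>2"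
        using base by eventually_elim (metis rescaled_upper)
    qed
    \<comment> \<open>The factor \<open>1 / (1 + \<rho> n)^2\<close> is split off, so that only
      \<open>(\<rho> n)^2\<close> and the error term need rescaling.\<close>
    have "(\<lambda>n. (1 - X n * (1 / W n)^2) * X n * (X n - 1 / W n)^2 / (1 - (1 / W n)^3)^2 * (1 / (1 + \<rho> n)^2)
        - (1 / W n) * (1 - X n * (1 / W n)^2) * (X n - 1 / W n)^2 / (1 - (1 / W n)^3 - X n * (1 / W n)^2)^2) \<longlonglongrightarrow> c ^ 3"
      by (rule tendsto_eq_intros lims \<rho>0 | simp add: eval_nat_numeral)+
    then show "(\<lambda>n. (real n - real (r n)) / real (r n) *
        ((\<rho> n / (1 + \<rho> n))\<^sup>2 - real (r n) * ((real (r n) - 1) / (real n - 1 - real (r n)))\<^sup>2)) \<longlonglongrightarrow> c ^ 3"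
    proof (rule Lim_transform_eventually)
      show "\<forall>\<^sub>F n in sequentially. (1 - X n * (1 / W n)^2) * X n * (X n - 1 / W n)^2 / (1 - (1 / W n)^3)^2 * (1 / (1 + \<rho> n)^2)
        - (1 / W n) * (1 - X n * (1 / W n)^2) * (X n - 1 / W n)^2 / (1 - (1 / W n)^3 - X n * (1 / W n)^2)^2 =
        (real n - real (r n)) / real (r n) *
        ((\<rho> n / (1 + \<rho> n))\<^sup>2 - real (r n) * ((real (r n) - 1) / (real n - 1 - real (r n)))\<^sup>2)"
        using base
      proof eventually_elim
        case (elim n)
        have 1: "(real n - real (r n)) / real (r n) * (\<rho> n)\<^sup>2 =
           (1 - X n * (1 / W n)^2) * X n * (X n - 1 / W n)^2 / (1 - (1 / W n)^3)^2"
          unfolding \<rho>_def using elim rescaled_lower[of "W n" "X n"] by metis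
        have 2: "(real n - real (r n)) / real (r n) * (real (r n) * ((real (r n) - 1) / (real n - 1 - real (r n)))\<^sup>2) =
           (1 / W n) * (1 - X n * (1 / W n)^2) * (X n - 1 / W n)^2 / (1 - (1 / W n)^3 - X n * (1 / W n)^2)^2"
          using elim rescaled_error[of "W n" "X n"] by metis
        have "p * (1 / (1 + x)^2) - q = a * ((x / (1 + x))\<^sup>2 - b)" if "a * x\<^sup>2 = p" "a * b = q" for a b p q x :: real
          unfolding that[symmetric] by (simp add: power_divide right_diff_distrib)
        from this[OF 1 2] show ?case .
      qed
    qed
  qed
  have M2: "(\<lambda>n. 2 / M n) \<longlonglongrightarrow> 0"
  proof (rule tendsto_sandwich[of "\<lambda>_. 0"])
    show "(\<lambda>n. 2 / (real n - 1)) \<longlonglongrightarrow> 0" by real_asymp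
    show "\<forall>\<^sub>F n in sequentially. 2 / M n \<le> 2 / (real n - 1)"
      using proc eventually_gt_at_top[of 1]
    proof eventually_elim
      case (elim n)
      then have "real n - 1 \<le> M n" unfolding M_def using intersecting_process.M_ge[of n "r n"] by linarith
      then show ?case using elim by (intro frac_le) auto
    qed
  qed (auto simp: M_def)
  have \<tau>: "\<tau> \<longlonglongrightarrow> 1 / (1 + c ^ 3)"
  proof (rule Lim_transform_eventually)
    have "1 + c ^ 3 \<noteq> 0" using c by (smt (verit) zero_le_power)
    then show "(\<lambda>n. (1 - 2 / M n) / (1 - 2 / M n + T n / M n)) \<longlonglongrightarrow> 1 / (1 + c ^ 3)"
      using tendsto_divide[OF tendsto_diff[OF tendsto_const[of 1] M2]
          tendsto_add[OF tendsto_diff[OF tendsto_const[of 1] M2] TM]] by simp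
    show "\<forall>\<^sub>F n in sequentially. (1 - 2 / M n) / (1 - 2 / M n + T n / M n) = \<tau> n"
      using proc
    proof eventually_elim
      case (elim n)
      then have "M n \<noteq> 0" unfolding M_def using intersecting_process.M_pos[of n "r n"] by simp
      then have "1 - 2 / M n = (M n - 2) / M n" "1 - 2 / M n + T n / M n = (M n - 2 + T n) / M n"
        by (simp_all add: diff_divide_distrib add_divide_distrib)
      then show ?case using \<open>M n \<noteq> 0\<close> by (simp add: \<tau>_def)
    qed
  qed
  show ?thesis
  proof (rule tendsto_sandwich)
    show "\<forall>\<^sub>F n in sequentially. \<tau> n - 2 * \<rho> n - err n \<le> probE n (r n)"
      using proc by eventually_elim
        (use intersecting_process.probE_near_\<tau>(2) in \<open>simp add: \<tau>_def \<rho>_def err_def M_def T_def\<close>)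
    show "\<forall>\<^sub>F n in sequentially. probE n (r n) \<le> \<tau> n + 2 * \<rho> n"
      using proc by eventually_elim
        (use intersecting_process.probE_near_\<tau>(1) in \<open>simp add: \<tau>_def \<rho>_def M_def T_def\<close>)
    show "(\<lambda>n. \<tau> n - 2 * \<rho> n - err n) \<longlonglongrightarrow> 1 / (1 + c ^ 3)"
      by (rule tendsto_eq_intros \<tau> \<rho>0 err0 | simp)+
    show "(\<lambda>n. \<tau> n + 2 * \<rho> n) \<longlonglongrightarrow> 1 / (1 + c ^ 3)"
      by (rule tendsto_eq_intros \<tau> \<rho>0 | simp)+
  qed
qed

text \<open>Each \<open>n\<close> is treated by the size of \<open>r n\<close> relative to
  \<open>n powr (3/5)\<close>, and the sum of the two bounds covers both cases. Any exponent
  strictly between 1/2 and 2/3 would do: below the threshold \<open>r^3 / n^2\<close> must vanish,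
  above it \<open>r^2 / n\<close> must grow like a power of \<open>n\<close>.\<close>

lemma probE_limit_supercritical:
  fixes r :: "nat \<Rightarrow> nat"
  assumes ev: "\<forall>\<^sub>F n in sequentially. 0 < r n \<and> 2 * r n < n"
    and lim: "filterlim (\<lambda>n. real (r n) / real n powr (1/3)) at_top sequentially"
  shows "(\<lambda>n. probE n (r n)) \<longlonglongrightarrow> 0"
proof -
  define X where "X n = real (r n) / real n powr (1/3)" for n
  let ?b = "\<lambda>n. 32 * (1 / X n ^ 3 + real n powr (-1/5)) + real n * (5 / 9) ^ (n - 1)"
  have X: "filterlim X at_top sequentially" using lim by (simp add: X_def[abs_def])
  have "\<forall>\<^sub>F n in sequentially. 64 \<le> X n" using X by (simp add: filterlim_at_top)
  moreover have "\<forall>\<^sub>F n::nat in sequentially. 64 * real n powr (9/5) \<le> real n ^ 2" by real_asymp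
  moreover have "\<forall>\<^sub>F n::nat in sequentially. real n * (exp (- (real n powr (1/5))) + 2 powr (- (real n powr (3/5)))) \<le> 1 / 10"
    by real_asymp
  ultimately have upper: "\<forall>\<^sub>F n in sequentially. probE n (r n) \<le> ?b n"
    using ev eventually_gt_at_top[of 0]
  proof eventually_elim
    case (elim n)
    interpret intersecting_process n "r n" using elim by unfold_locales auto
    have n0: "0 < real n" using elim by simp
    have "1 \<le> real n powr (1/3)" using elim by (intro ge_one_powr_ge_zero) auto
    then have "64 * 1 \<le> X n * real n powr (1/3)" using elim by (intro mult_mono) auto
    also have "\<dots> = real (r n)" using n0 by (simp add: X_def)
    finally have r64: "64 \<le> r n" by simp
    have pw: "(real n powr a) ^ k = real n powr (a * real k)" for a k
      using n0 by (simp add: powr_realpow[symmetric] powr_powr)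
    show ?case
    proof (cases "real (r n) \<le> real n powr (3/5)")
      case True
      have "real (r n) ^ 3 \<le> (real n powr (3/5)) ^ 3" using True by (intro power_mono) auto
      then have r3: "real (r n) ^ 3 \<le> real n powr (9/5)" by (simp add: pw)
      then have "64 * real (r n) ^ 3 \<le> real n ^ 2" using elim by linarith
      with r64 have "probE n (r n) \<le> 32 * (real n / real (r n) ^ 3 + real (r n) ^ 3 / real n ^ 2)"
        by (rule probE_le_middle)
      moreover have "real n / real (r n) ^ 3 = 1 / X n ^ 3"
        by (simp add: X_def power_divide pw)
      moreover have "real (r n) ^ 3 / real n ^ 2 \<le> real n powr (-1/5)"
      proof -
        have "real (r n) ^ 3 / real n ^ 2 \<le> real n powr (9/5) / real n powr 2"
          using r3 n0 by (intro frac_le) (auto simp: powr_numeral)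
        also have "\<dots> = real n powr (9/5 - 2)" by (simp only: powr_diff)
        also have "\<dots> = real n powr (-1/5)" by simp
        finally show ?thesis .
      qed
      moreover have "0 \<le> real n * (5 / 9) ^ (n - 1)" by simp
      ultimately show ?thesis by (smt (verit))
    next
      case False
      then have rl: "real n powr (3/5) \<le> real (r n)" by simp
      have "(real n powr (3/5)) ^ 2 \<le> real (r n) ^ 2" using rl by (intro power_mono) auto
      then have "real n powr (6/5) / real n powr 1 \<le> real (r n) ^ 2 / real n"
        using n0 by (simp add: pw divide_right_mono)
      then have "real n powr (1/5) \<le> real (r n) ^ 2 / real n"
        unfolding powr_diff[symmetric] by simp
      then have 1: "exp (- (real (r n) ^ 2 / real n)) \<le> exp (- (real n powr (1/5)))" by simp
      have "1 / 2 ^ r n = 2 powr (- real (r n))" by (simp add: powr_minus powr_realpow divide_inverse)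
      also have "\<dots> \<le> 2 powr (- (real n powr (3/5)))" using rl by (intro powr_mono) auto
      finally have "real n * (exp (- (real (r n) ^ 2 / real n)) + 1 / 2 ^ r n) \<le>
          real n * (exp (- (real n powr (1/5))) + 2 powr (- (real n powr (3/5))))"
        using 1 by (intro mult_left_mono add_mono) auto
      also have "\<dots> \<le> 1 / 10" using elim by blast
      finally have "probE n (r n) \<le> real n * (5 / 9) ^ (n - 1)"
        using r64 by (intro probE_le_large) simp_all
      moreover have "0 \<le> 1 / X n ^ 3" using elim by simp
      ultimately show ?thesis by (smt (verit) powr_ge_zero)
    qed
  qed
  have "?b \<longlonglongrightarrow> 0"
  proof -
    have "(\<lambda>n. (inverse (X n)) ^ 3) \<longlonglongrightarrow> 0 ^ 3"
      using tendsto_inverse_0_at_top[OF X] by (intro tendsto_intros)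
    then have 1: "(\<lambda>n. 1 / X n ^ 3) \<longlonglongrightarrow> 0" by (simp add: power_inverse divide_inverse)
    have 2: "(\<lambda>n::nat. real n powr (-1/5)) \<longlonglongrightarrow> 0" by real_asymp
    have 3: "(\<lambda>n::nat. real n * (5 / 9) ^ (n - 1)) \<longlonglongrightarrow> 0" by real_asymp
    show ?thesis
      using tendsto_add[OF tendsto_mult[OF tendsto_const[of 32] tendsto_add[OF 1 2]] 3] by simp
  qed
  then show ?thesis
    by (rule tendsto_sandwich[OF _ upper tendsto_const, rotated]) (simp add: probE_nonneg)
qed

theorem theorem1:
  fixes r :: "nat \<Rightarrow> nat"
  assumes "\<forall>\<^sub>F n in sequentially. 0 < r n \<and> 2 * r n < n"
  shows "(((\<lambda>n. real (r n) / real n powr (1/3)) \<longlonglongrightarrow> 0) \<longrightarrow>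
            ((\<lambda>n. probE n (r n)) \<longlonglongrightarrow> 1))
       \<and> (\<forall>c::real. c > 0 \<longrightarrow> ((\<lambda>n. real (r n) / real n powr (1/3)) \<longlonglongrightarrow> c) \<longrightarrow>
            ((\<lambda>n. probE n (r n)) \<longlonglongrightarrow> 1 / (1 + c ^ 3)))
       \<and> (filterlim (\<lambda>n. real (r n) / real n powr (1/3)) at_top sequentially \<longrightarrow>
            ((\<lambda>n. probE n (r n)) \<longlonglongrightarrow> 0))"
proof (intro conjI allI impI)
  assume lim: "(\<lambda>n. real (r n) / real n powr (1/3)) \<longlonglongrightarrow> 0"
  \<comment> \<open>Values \<open>r n = 1\<close> are raised to 2 so that the critical case applies
    with limit 0. This cannot increase \<open>probE\<close>, which equals 1 at
    \<open>r n = 1\<close>.\<close>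
  define s where "s n = max (r n) 2" for n
  have "(\<lambda>n. max (real (r n) / real n powr (1/3)) (2 / real n powr (1/3))) \<longlonglongrightarrow> max 0 0"
  proof (rule tendsto_max[OF lim])
    show "(\<lambda>n::nat. 2 / real n powr (1/3)) \<longlonglongrightarrow> 0" by real_asymp
  qed
  moreover have "real (s n) / real n powr (1/3) = max (real (r n) / real n powr (1/3)) (2 / real n powr (1/3))" for n
  proof (cases "r n \<le> 2")
    case True
    then have "real (r n) / real n powr (1/3) \<le> 2 / real n powr (1/3)" by (intro divide_right_mono) auto
    then show ?thesis using True by (simp add: s_def max_absorb2)
  next
    case False
    then have "2 / real n powr (1/3) \<le> real (r n) / real n powr (1/3)" by (intro divide_right_mono) auto
    then show ?thesis using False by (simp add: s_def max_absorb1)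
  qed
  ultimately have slim: "(\<lambda>n. real (s n) / real n powr (1/3)) \<longlonglongrightarrow> 0" by simp
  have "\<forall>\<^sub>F n in sequentially. 2 \<le> s n \<and> 2 * s n < n"
    using assms eventually_gt_at_top[of 4] by eventually_elim (auto simp: s_def max_def)
  from probE_limit_critical[OF this slim] have slim1: "(\<lambda>n. probE n (s n)) \<longlonglongrightarrow> 1" by simp
  have lower: "\<forall>\<^sub>F n in sequentially. probE n (s n) \<le> probE n (r n)"
    using assms eventually_ge_at_top[of 3]
  proof eventually_elim
    case (elim n)
    show ?case
    proof (cases "r n = 1")
      case True
      then show ?thesis using probE_singletons[of n] probE_le_1 elim by simp
    next
      case False
      then have "s n = r n" using elim by (simp add: s_def)
      then show ?thesis by simp
    qed
  qed
  show "(\<lambda>n. probE n (r n)) \<longlonglongrightarrow> 1"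
    by (rule tendsto_sandwich[OF lower _ slim1 tendsto_const]) (simp add: probE_le_1)
next
  fix c :: real
  assume c: "0 < c" and lim: "(\<lambda>n. real (r n) / real n powr (1/3)) \<longlonglongrightarrow> c"
  have "\<forall>\<^sub>F n in sequentially. c / 2 < real (r n) / real n powr (1/3)"
    using lim c by (intro order_tendstoD(1)) auto
  \<comment> \<open>The constant makes \<open>r n\<close> exceed
    \<open>c / 2 * (4 / c) = 2\<close>.\<close>
  moreover have "\<forall>\<^sub>F n in sequentially. 4 / c < real n powr (1/3)" by real_asymp
  ultimately have "\<forall>\<^sub>F n in sequentially. 2 \<le> r n \<and> 2 * r n < n"
    using assms
  proof eventually_elim
    case (elim n)
    have "c / 2 * (4 / c) < real (r n) / real n powr (1/3) * real n powr (1/3)"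
      using elim c by (intro mult_strict_mono) auto
    then have "2 < real (r n)" using c elim by simp
    then show ?case using elim by simp
  qed
  from probE_limit_critical[OF this lim] c
  show "(\<lambda>n. probE n (r n)) \<longlonglongrightarrow> 1 / (1 + c ^ 3)" by simp
next
  assume "filterlim (\<lambda>n. real (r n) / real n powr (1/3)) at_top sequentially"
  with assms show "(\<lambda>n. probE n (r n)) \<longlonglongrightarrow> 0" by (rule probE_limit_supercritical)
qed

end
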